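(* The constraint $W=1$ is compatible with the Poisson brackets for the scaling invariant $\eta=\phi/\psi$ (i.e. $\eta$ commutes with the wronskian $W=\phi\psi'-\phi'\psi$) if and only if the last term in the formula $$\{W(x),\phi(y)\}=(c(x-y)-2a(x-y))W(x)\phi(y)-c'(x-y)\phi(x)[\phi(x)\psi(y)-\psi(x)\phi(y)]$$ is identically zero; this is possible if and only if $c'(x-y)$ is a multiple of $\delta(x-y)$, i.e., if $c(x-y)$ is a multiple of $\operatorname{sign}(x-y)$.
   Context: $w=(\phi,\psi):\mathbb{R}\to\mathbb{C}^2$ is a smooth quasi-periodic plane curve (row vector), $w(x+2\pi)=w(x)M$, $M\in SL(2,\mathbb{C})$. The Poisson bracket of evaluation functionals is $\{w_1(x),w_2(y)\}=w_1(x)w_2(y)R(x-y)$, where $w_1(x)w_2(y)=w(x)\otimes w(y)$ is a row vector of length 4 and $$R(x-y)=a(x-y)\,I+\begin{pmatrix}0&0&0&0\\0&c&-c&0\\0&-c&c&0\\0&0&0&0\end{pmatrix}+r,\qquad c=c(x-y),$$ with $a,c$ odd functions and $r\in\mathfrak{sl}(2)\wedge\mathfrak{sl}(2)$ (viewed as a $4\times4$ matrix) a classical r-matrix, conjugate to one of: (a) $r=0$; (b) $r=h\wedge f$; (c) $r=\epsilon\,e\wedge f$ with $\epsilon\ne0$, where $h,e,f$ are the standard generators of $\mathfrak{sl}(2)$. The Jacobi identity amounts to $c(x-y)c(y-z)+c(y-z)c(z-x)+c(z-x)c(x-y)=0$ in cases (a),(b) and $=-\epsilon^2$ in case (c). $c'$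 is the derivative of $c$ and $\delta$ the Dirac delta function. A similar formula, obtained by symmetry, holds for $\{W(x),\psi(y)\}$. The scaling group is the group of nowhere zero $2\pi$-periodic functions acting by $w\mapsto fw$.
   Formalization: In the displayed formula the coefficient c(x-y)-2a(x-y) is corrected to c(x-y)+2a(x-y), as the stated R gives; the printed sign fails e.g. for r=0, c=0, a=sign, w=(1,x). *)

theory Defs
  imports "HOL-Analysis.Analysis"
begin

section \<open>Smooth functions and distributions\<close>

text \<open>All iterated directional derivatives exist and are (Frechet) differentiable. On a
  finite-dimensional domain this is \<open>C\<^sup>\<infinity>\<close>.\<close>

coinductive smooth :: "('a::real_normed_vector \<Rightarrow> 'b::real_normed_vector) \<Rightarrow> bool" where
  "(\<And>x. (f has_derivative f' x) (at x)) \<Longrightarrow> (\<And>v. smooth (\<lambda>x. f' x v)) \<Longrightarrow> smooth f"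

definition test_function_on :: "'a::real_normed_vector set \<Rightarrow> ('a \<Rightarrow> complex) \<Rightarrow> bool" where
  "test_function_on U f \<longleftrightarrow>
     smooth f \<and> compact (closure {x. f x \<noteq> 0}) \<and> closure {x. f x \<noteq> 0} \<subseteq> U"

text \<open>A distribution is a functional on test functions; its values at other functions are
  irrelevant, so distributions are compared by \<open>eq_on\<close>, never by \<open>=\<close>.\<close>

type_synonym 'a functional = "('a \<Rightarrow> complex) \<Rightarrow> complex"

definition eq_on :: "'a::real_normed_vector set \<Rightarrow> 'a functional \<Rightarrow> 'a functional \<Rightarrow> bool" where
  "eq_on U S T \<longleftrightarrow> (\<forall>f. test_function_on U f \<longrightarrow> S f = T f)"

definition vderiv :: "(real \<Rightarrow> 'b::real_normed_vector) \<Rightarrow> real \<Rightarrow> 'b" where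
  "vderiv f = (\<lambda>x. vector_derivative f (at x))"

definition distribution :: "real functional \<Rightarrow> bool" where
  "distribution T \<longleftrightarrow>
     (\<forall>f g. test_function_on UNIV f \<longrightarrow> test_function_on UNIV g \<longrightarrow>
        T (\<lambda>t. f t + g t) = T f + T g) \<and>
     (\<forall>f k. test_function_on UNIV f \<longrightarrow> T (\<lambda>t. k * f t) = k * T f) \<and>
     (\<forall>K. compact K \<longrightarrow>
        (\<exists>N C. \<forall>f B. test_function_on UNIV f \<longrightarrow> {t. f t \<noteq> 0} \<subseteq> K \<longrightarrow>
           (\<forall>k\<le>N. \<forall>t. norm ((vderiv ^^ k) f t) \<le> B) \<longrightarrow> norm (T f) \<le> C * B))"

definition regular :: "(real \<Rightarrow> complex) \<Rightarrow> real functional" where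
  "regular g = (\<lambda>f. integral UNIV (\<lambda>t. g t * f t))"

definition dirac :: "real functional" where
  "dirac = (\<lambda>f. f 0)"

definition distr_deriv :: "real functional \<Rightarrow> real functional" where
  "distr_deriv T = (\<lambda>f. - T (vderiv f))"

text \<open>Odd functions such as \<open>1/t\<close>, \<open>cot t\<close>, \<open>coth t\<close> are not locally integrable at their poles
  and act on test functions by regularization (e.g. the principal value), so a function is given
  together with the odd distribution \<open>T\<close> that it stands for. The function need only be
  locally integrable off a locally finite set \<open>S\<close>, and there it determines \<open>T\<close>.\<close>

definition odd_generalized_function ::
    "(real \<Rightarrow> complex) \<Rightarrow> real set \<Rightarrow> real functional \<Rightarrow> bool" where
  "odd_generalized_function g S T \<longleftrightarrow>
     (\<forall>t. g (- t) = - g t) \<and>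
     (\<forall>b. finite (S \<inter> {-b..b})) \<and>
     (\<forall>K. compact K \<longrightarrow> K \<inter> S = {} \<longrightarrow> g absolutely_integrable_on K) \<and>
     distribution T \<and>
     (\<forall>f. test_function_on UNIV f \<longrightarrow> T (\<lambda>t. f (- t)) = - T f) \<and>
     eq_on (- S) T (regular g)"


section \<open>Distributions in two variables\<close>

definition mult :: "('a \<Rightarrow> complex) \<Rightarrow> 'a functional \<Rightarrow> 'a functional" where
  "mult m K = (\<lambda>\<Phi>. K (\<lambda>p. m p * \<Phi> p))"

definition ddx :: "(real \<times> real) functional \<Rightarrow> (real \<times> real) functional" where
  "ddx K = (\<lambda>\<Phi>. - K (\<lambda>(x, y). vderiv (\<lambda>t. \<Phi> (t, y)) x))"

definition ddy :: "(real \<times> real) functional \<Rightarrow> (real \<times> real) functional" where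
  "ddy K = (\<lambda>\<Phi>. - K (\<lambda>(x, y). vderiv (\<lambda>t. \<Phi> (x, t)) y))"

text \<open>The distribution \<open>T(x - y)\<close>; for \<open>T = regular g\<close> it is integration against \<open>g (x - y)\<close>.\<close>

definition of_difference :: "real functional \<Rightarrow> (real \<times> real) functional" where
  "of_difference T = (\<lambda>\<Phi>. T (\<lambda>s. integral UNIV (\<lambda>y. \<Phi> (y + s, y))))"


section \<open>The matrix R\<close>

text \<open>The \<open>4 \<times> 4\<close> matrices are indexed by pairs, in the order (1,1), (1,2), (2,1), (2,2).\<close>

type_synonym mat2 = "complex^2^2"
type_synonym mat4 = "complex^(2 \<times> 2)^(2 \<times> 2)"

definition kron :: "mat2 \<Rightarrow> mat2 \<Rightarrow> mat4" where
  "kron A B = (\<chi> p q. A $ fst p $ fst q * B $ snd p $ snd q)"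

definition wedge :: "mat2 \<Rightarrow> mat2 \<Rightarrow> mat4" where
  "wedge A B = kron A B - kron B A"

definition sl2_e :: mat2 where "sl2_e = vector [vector [0, 1], vector [0, 0]]"
definition sl2_f :: mat2 where "sl2_f = vector [vector [0, 0], vector [1, 0]]"
definition sl2_h :: mat2 where "sl2_h = vector [vector [1, 0], vector [0, -1]]"

definition conjugate4 :: "mat4 \<Rightarrow> mat4 \<Rightarrow> bool" where
  "conjugate4 r r0 \<longleftrightarrow>
     (\<exists>g :: mat2. det g = 1 \<and> r = kron g g ** r0 ** kron (matrix_inv g) (matrix_inv g))"

text \<open>The classical r-matrices, with the constant \<open>\<kappa>\<close> on the right-hand side of the
  functional equation for \<open>c\<close> that expresses the Jacobi identity.\<close>

definition classical_r_matrix :: "mat4 \<Rightarrow> complex \<Rightarrow> bool" where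
  "classical_r_matrix r \<kappa> \<longleftrightarrow>
     conjugate4 r 0 \<and> \<kappa> = 0 \<or>
     conjugate4 r (wedge sl2_h sl2_f) \<and> \<kappa> = 0 \<or>
     (\<exists>\<epsilon>. \<epsilon> \<noteq> 0 \<and> conjugate4 r (\<chi> p q. \<epsilon> * wedge sl2_e sl2_f $ p $ q) \<and> \<kappa> = - \<epsilon>\<^sup>2)"

definition jacobi_condition :: "(real \<Rightarrow> complex) \<Rightarrow> real set \<Rightarrow> complex \<Rightarrow> bool" where
  "jacobi_condition c S \<kappa> \<longleftrightarrow>
     (\<forall>x y z. x - y \<notin> S \<longrightarrow> y - z \<notin> S \<longrightarrow> z - x \<notin> S \<longrightarrow>
        c (x - y) * c (y - z) + c (y - z) * c (z - x) + c (z - x) * c (x - y) = \<kappa>)"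

text \<open>The matrix multiplying \<open>c\<close>: its middle block is (1, -1; -1, 1), all else is 0.\<close>

definition c_block :: mat4 where
  "c_block = (\<chi> p q. if fst p = snd p \<or> fst q = snd q then 0 else if p = q then 1 else - 1)"

definition R_entry ::
    "real functional \<Rightarrow> real functional \<Rightarrow> mat4 \<Rightarrow> 2 \<times> 2 \<Rightarrow> 2 \<times> 2 \<Rightarrow> real functional" where
  "R_entry a c r p q =
     (\<lambda>f. mat 1 $ p $ q * a f + c_block $ p $ q * c f + r $ p $ q * regular (\<lambda>_. 1) f)"


section \<open>Curves and brackets\<close>

definition quasi_periodic_curve :: "(real \<Rightarrow> complex^2) \<Rightarrow> bool" where
  "quasi_periodic_curve w \<longleftrightarrow>
     smooth w \<and> (\<exists>M :: mat2. det M = 1 \<and> (\<forall>x. w (x + 2 * pi) = w x v* M))"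

text \<open>Component \<open>(i, j)\<close> of the row vector \<open>w(x) \<otimes> w(y) R(x - y)\<close>, i.e. the bracket of the
  evaluation functionals \<open>w\<^sub>i(x)\<close> and \<open>w\<^sub>j(y)\<close> at the curve \<open>w\<close>.\<close>

definition eval_bracket ::
    "real functional \<Rightarrow> real functional \<Rightarrow> mat4 \<Rightarrow> (real \<Rightarrow> complex^2) \<Rightarrow> 2 \<Rightarrow> 2 \<Rightarrow>
       (real \<times> real) functional" where
  "eval_bracket a c r w i j =
     (\<lambda>\<Phi>. \<Sum>k\<in>UNIV. \<Sum>l\<in>UNIV.
        mult (\<lambda>(x, y). w x $ k * w y $ l) (of_difference (R_entry a c r (k, l) (i, j))) \<Phi>)"

text \<open>A local functional \<open>w \<mapsto> F(w(x), w'(x))\<close> is given by its density \<open>F\<close>, a function of the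
  value \<open>u\<close> and the derivative \<open>v\<close>.\<close>

type_synonym density = "complex^2 \<Rightarrow> complex^2 \<Rightarrow> complex"

definition d_value :: "density \<Rightarrow> 2 \<Rightarrow> (real \<Rightarrow> complex^2) \<Rightarrow> real \<Rightarrow> complex" where
  "d_value F i w x = deriv (\<lambda>t. F (w x + t *s axis i 1) (vderiv w x)) 0"

definition d_deriv :: "density \<Rightarrow> 2 \<Rightarrow> (real \<Rightarrow> complex^2) \<Rightarrow> real \<Rightarrow> complex" where
  "d_deriv F i w x = deriv (\<lambda>t. F (w x) (vderiv w x + t *s axis i 1)) 0"

text \<open>The bracket \<open>{F(x), G(y)}\<close> at \<open>w\<close>: the extension of the bracket of evaluation functionals
  as a derivation in each argument, where the bracket of \<open>w\<^sub>i'(x)\<close> is the \<open>x\<close>-derivative of that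
  of \<open>w\<^sub>i(x)\<close>, and likewise in \<open>y\<close>.\<close>

definition bracket ::
    "real functional \<Rightarrow> real functional \<Rightarrow> mat4 \<Rightarrow> density \<Rightarrow> density \<Rightarrow>
       (real \<Rightarrow> complex^2) \<Rightarrow> (real \<times> real) functional" where
  "bracket a c r F G w =
     (\<lambda>\<Phi>. \<Sum>i\<in>UNIV. \<Sum>j\<in>UNIV. let K = eval_bracket a c r w i j in
        mult (\<lambda>(x, y). d_value F i w x * d_value G j w y) K \<Phi>
      + mult (\<lambda>(x, y). d_deriv F i w x * d_value G j w y) (ddx K) \<Phi>
      + mult (\<lambda>(x, y). d_value F i w x * d_deriv G j w y) (ddy K) \<Phi>
      + mult (\<lambda>(x, y). d_deriv F i w x * d_deriv G j w y) (ddx (ddy K)) \<Phi>)"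

definition phi_density :: density where
  "phi_density u v = u $ 1"

definition wronskian_density :: density where
  "wronskian_density u v = u $ 1 * v $ 2 - v $ 1 * u $ 2"

definition eta_density :: density where
  "eta_density u v = u $ 1 / u $ 2"

definition wronskian :: "(real \<Rightarrow> complex^2) \<Rightarrow> real \<Rightarrow> complex" where
  "wronskian w x = wronskian_density (w x) (vderiv w x)"

text \<open>Compatibility of the constraint \<open>W = 1\<close> with the brackets of \<open>\<eta> = \<phi>/\<psi>\<close>: \<open>\<eta>\<close> commutes
  with \<open>W\<close>. As \<open>\<eta>(y)\<close> is an affine coordinate, defined where \<open>\<psi>(y) \<noteq> 0\<close>, the bracket is a
  distribution on that open set.\<close>

definition eta_commutes_with_wronskian ::
    "real functional \<Rightarrow> real functional \<Rightarrow> mat4 \<Rightarrow> bool" where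
  "eta_commutes_with_wronskian a c r \<longleftrightarrow>
     (\<forall>w. quasi_periodic_curve w \<longrightarrow>
        eq_on {(x, y). w y $ 2 \<noteq> 0} (bracket a c r wronskian_density eta_density w) (\<lambda>_. 0))"

text \<open>\<open>c'(x - y) \<phi>(x) [\<phi>(x) \<psi>(y) - \<psi>(x) \<phi>(y)]\<close>\<close>

definition last_term ::
    "real functional \<Rightarrow> (real \<Rightarrow> complex^2) \<Rightarrow> (real \<times> real) functional" where
  "last_term c w =
     mult (\<lambda>(x, y). w x $ 1 * (w x $ 1 * w y $ 2 - w x $ 2 * w y $ 1))
       (of_difference (distr_deriv c))"

end

theory Submission
  imports Defs
begin

text \<open>For constant \<open>R\<close> the bracket with \<open>W\<close> sees only the partial trace of \<open>R\<close> over the first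
  tensor factor: 2 for the identity, 1 for the matrix multiplying \<open>c\<close>, and 0 for \<open>r\<close>, because
  conjugation keeps the factors of a wedge traceless. The \<open>x\<close>-derivative in \<open>W\<close> adds the term with
  \<open>c'\<close>, and for \<open>\<eta>\<close> only
  \<open>c'(x - y) [\<phi>(x) \<psi>(y) - \<psi>(x) \<phi>(y)]\<^sup>2 / \<psi>(y)\<^sup>2\<close> survives.
  If \<open>c' = k \<delta>\<close>, this term and the last term vanish, as their coefficients vanish on the diagonal.
  Conversely, the curve \<open>(1, x)\<close> turns the vanishing of the last term into \<open>t c'(t) = 0\<close>, and
  the curve \<open>(x, 1)\<close> turns the commutation of \<open>\<eta>\<close> and \<open>W\<close> into \<open>t\<^sup>2 c'(t) = 0\<close>; each forces
  \<open>c' = k \<delta>\<close>, the second because \<open>c'\<close> is even. Finally, the odd part of a test function has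
  a primitive that is a test function, which determines the odd distribution \<open>c\<close> from \<open>c'\<close>.\<close>

section \<open>Smooth functions\<close>

lemma smooth_derivative:
  assumes "smooth f"
  shows "\<exists>f'. (\<forall>x. (f has_derivative f' x) (at x)) \<and> (\<forall>v. smooth (\<lambda>x. f' x v))"
  using assms by (cases rule: smooth.cases) blast

lemma smooth_continuous_on: "smooth f \<Longrightarrow> continuous_on S f"
  by (auto dest!: smooth_derivative intro: continuous_at_imp_continuous_on has_derivative_continuous)

lemma smooth_const: "smooth (\<lambda>x. c)"
proof -
  \<comment> \<open>The coinduction runs over all constants at once, since the derivative of a
    constant is the constant 0.\<close>
  have "\<exists>c. f = (\<lambda>x. c) \<Longrightarrow> smooth f" for f :: "'a::real_normed_vector \<Rightarrow> 'b::real_normed_vector"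
  proof (coinduction arbitrary: f)
    case smooth
    then show ?case
      by (intro exI[of _ f] exI[of _ "\<lambda>_ _. 0"]) (auto intro!: derivative_eq_intros)
  qed
  then show ?thesis by blast
qed

lemma smooth_bounded_linear:
  assumes "bounded_linear L"
  shows "smooth L"
  by (rule smooth.intros[where f' = "\<lambda>_. L"])
     (use assms in \<open>auto intro: bounded_linear_imp_has_derivative smooth_const\<close>)

lemma smooth_linear_comp:
  assumes "smooth f" "bounded_linear L"
  shows "smooth (\<lambda>x. L (f x))"
  using assms(1)
proof (coinduction arbitrary: f)
  case smooth
  obtain f' where f': "\<And>x. (f has_derivative f' x) (at x)" "\<And>v. smooth (\<lambda>x. f' x v)"
    using smooth_derivative[OF smooth] by blast
  show ?case
    by (intro exI[of _ "\<lambda>x. L (f x)"] exI[of _ "\<lambda>x v. L (f' x v)"] conjI allI refl)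
       (auto intro!: f' bounded_linear.has_derivative[OF assms(2)])
qed

text \<open>Each directional derivative \<open>f' (c + L x) (L v)\<close> is again a smooth function
  composed with the same affine map. The coinduction thus closes without sums or products, whatever
  the codomain.\<close>

lemma smooth_comp_affine:
  assumes "smooth f" "bounded_linear L"
  shows "smooth (\<lambda>x. f (c + L x))"
  using assms(1)
proof (coinduction arbitrary: f)
  case smooth
  obtain f' where f': "\<And>x. (f has_derivative f' x) (at x)" "\<And>v. smooth (\<lambda>x. f' x v)"
    using smooth_derivative[OF smooth] by blast
  have "((\<lambda>x. f (c + L x)) has_derivative (\<lambda>v. f' (c + L x) (L v))) (at x)" for x
    by (rule has_derivative_compose[OF _ f'(1)])
       (auto intro!: derivative_eq_intros bounded_linear_imp_has_derivative assms)
  then show ?case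
    by (intro exI[of _ "\<lambda>x. f (c + L x)"] exI[of _ "\<lambda>x v. f' (c + L x) (L v)"] conjI allI refl)
       (use f'(2) in \<open>auto intro!: exI[of _ "\<lambda>x. f' x (L _)"]\<close>)
qed

text \<open>Derivatives of products and composites are sums of such, so coinduction for \<open>smooth\<close> needs
  a class that is closed under all of these operations.\<close>

inductive smooth_closure :: "('a::real_normed_vector \<Rightarrow> complex) \<Rightarrow> bool" where
  base: "smooth f \<Longrightarrow> smooth_closure f"
| add: "smooth_closure f \<Longrightarrow> smooth_closure g \<Longrightarrow> smooth_closure (\<lambda>x. f x + g x)"
| mult: "smooth_closure f \<Longrightarrow> smooth_closure g \<Longrightarrow> smooth_closure (\<lambda>x. f x * g x)"
| comp: "smooth h \<Longrightarrow> smooth q \<Longrightarrow> smooth_closure (\<lambda>x. h (q x :: real))"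

lemma smooth_closure_deriv:
  "smooth_closure f \<Longrightarrow>
     \<exists>f'. (\<forall>x. (f has_derivative f' x) (at x)) \<and> (\<forall>v. smooth_closure (\<lambda>x. f' x v))"
proof (induction rule: smooth_closure.induct)
  case (base f)
  from smooth_derivative[OF base] obtain f' where f': "(\<forall>x. (f has_derivative f' x) (at x)) \<and>
      (\<forall>v. smooth (\<lambda>x. f' x v))" ..
  show ?case
    by (rule exI[of _ f'], intro conjI allI)
      (rule f'[THEN conjunct1, rule_format], rule smooth_closure.base[OF f'[THEN conjunct2, rule_format]])
next
  case (add f g)
  from add.IH(1) obtain f' where f': "(\<forall>x. (f has_derivative f' x) (at x)) \<and>
      (\<forall>v. smooth_closure (\<lambda>x. f' x v))" ..
  from add.IH(2) obtain g' where g': "(\<forall>x. (g has_derivative g' x) (at x)) \<and>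
      (\<forall>v. smooth_closure (\<lambda>x. g' x v))" ..
  show ?case
    by (intro exI[of _ "\<lambda>x v. f' x v + g' x v"])
       (rule conjI allI has_derivative_add smooth_closure.add f'[THEN conjunct1, rule_format] g'[THEN conjunct1, rule_format]
           f'[THEN conjunct2, rule_format] g'[THEN conjunct2, rule_format])+
next
  case (mult f g)
  from mult.IH(1) obtain f' where f': "(\<forall>x. (f has_derivative f' x) (at x)) \<and>
      (\<forall>v. smooth_closure (\<lambda>x. f' x v))" ..
  from mult.IH(2) obtain g' where g': "(\<forall>x. (g has_derivative g' x) (at x)) \<and>
      (\<forall>v. smooth_closure (\<lambda>x. g' x v))" ..
  show ?case
    by (intro exI[of _ "\<lambda>x v. f x * g' x v + f' x v * g x"])
       (rule conjI allI has_derivative_mult smooth_closure.add smooth_closure.mult mult.hyps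
         f'[THEN conjunct1, rule_format] g'[THEN conjunct1, rule_format]
           f'[THEN conjunct2, rule_format] g'[THEN conjunct2, rule_format])+
next
  case (comp h q)
  obtain h' where h': "\<And>x. (h has_derivative h' x) (at x)" "\<And>v. smooth (\<lambda>x. h' x v)"
    using comp(1) smooth_derivative by metis
  obtain q' where q': "\<And>x. (q has_derivative q' x) (at x)" "\<And>v. smooth (\<lambda>x. q' x v)"
    using comp(2) smooth_derivative by metis
  \<comment> \<open>A linear map on the reals is multiplication by its value at 1. This turns the
    chain rule into a product of members of the class.\<close>
  have "h' (q x) (q' x v) = of_real (q' x v) * h' (q x) 1" for x v
    using linear_scale[OF has_derivative_linear[OF h'(1)], of "q x" "q' x v" 1]
    by (simp add: scaleR_conv_of_real)
  moreover have "smooth_closure (\<lambda>x. of_real (q' x v) * h' (q x) 1)" for v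
  proof (rule smooth_closure.mult)
    show "smooth_closure (\<lambda>x. of_real (q' x v) :: complex)"
      by (rule smooth_closure.base[OF smooth_linear_comp[OF q'(2) bounded_linear_of_real]])
    show "smooth_closure (\<lambda>x. h' (q x) 1)"
      by (rule smooth_closure.comp[OF h'(2) comp(2)])
  qed
  ultimately have "smooth_closure (\<lambda>x. h' (q x) (q' x v))" for v by (simp only:)
  then show ?case
    by (intro exI[of _ "\<lambda>x v. h' (q x) (q' x v)"] conjI allI has_derivative_compose[OF q'(1) h'(1)]) assumption
qed

lemma smooth_closure_smooth: "smooth_closure f \<Longrightarrow> smooth f"
proof (coinduction arbitrary: f)
  case smooth
  show ?case
    using smooth_closure_deriv[OF smooth] by blast
qed

lemma smooth_add: "smooth f \<Longrightarrow> smooth g \<Longrightarrow> smooth (\<lambda>x. f x + g x :: complex)"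
  by (blast intro: smooth_closure_smooth[OF smooth_closure.add] smooth_closure.base)

lemma smooth_mult: "smooth f \<Longrightarrow> smooth g \<Longrightarrow> smooth (\<lambda>x. f x * g x :: complex)"
  by (blast intro: smooth_closure_smooth[OF smooth_closure.mult] smooth_closure.base)

lemma smooth_comp_real: "smooth h \<Longrightarrow> smooth q \<Longrightarrow> smooth (\<lambda>x. h (q x :: real) :: complex)"
  by (rule smooth_closure_smooth[OF smooth_closure.comp])

lemma smooth_uminus: "smooth f \<Longrightarrow> smooth (\<lambda>x. - f x)"
  by (rule smooth_linear_comp) (auto intro: bounded_linear_minus bounded_linear_ident)

lemma smooth_diff: "smooth f \<Longrightarrow> smooth g \<Longrightarrow> smooth (\<lambda>x. f x - g x :: complex)"
  using smooth_add[of f "\<lambda>x. - g x"] smooth_uminus[of g] by simp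

lemma smooth_power: "smooth f \<Longrightarrow> smooth (\<lambda>x. f x ^ n :: complex)"
  by (induction n) (auto intro: smooth_const smooth_mult)

lemma smooth_vec_nth: "smooth w \<Longrightarrow> smooth (\<lambda>x. w x $ i)"
  by (rule smooth_linear_comp[OF _ bounded_linear_vec_nth])

lemma smooth_fst: "smooth f \<Longrightarrow> smooth (\<lambda>p. f (fst p))"
  using smooth_comp_affine[OF _ bounded_linear_fst, of f 0] by simp

lemma smooth_snd: "smooth f \<Longrightarrow> smooth (\<lambda>p. f (snd p))"
  using smooth_comp_affine[OF _ bounded_linear_snd, of f 0] by simp

section \<open>Derivatives in one real variable and partial derivatives in the plane\<close>

lemma has_derivative_imp_has_vector_derivative:
  assumes "(f has_derivative f') (at x)"
  shows "(f has_vector_derivative f' 1) (at x)"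
proof -
  have "(\<lambda>v. v *\<^sub>R f' 1) = f'"
    using linear_scale[OF has_derivative_linear[OF assms], of _ 1, symmetric] by (simp add: fun_eq_iff)
  then show ?thesis
    using assms by (simp add: has_vector_derivative_def)
qed

lemma vderivI: "(f has_vector_derivative d) (at x) \<Longrightarrow> vderiv f x = d"
  by (simp add: vderiv_def vector_derivative_at)

lemma smooth_has_vector_derivative:
  assumes "smooth f"
  shows "(f has_vector_derivative vderiv f x) (at x)"
  unfolding vderiv_def vector_derivative_works[symmetric]
  using smooth_derivative[OF assms] by (auto intro: differentiableI)

lemma smooth_vderiv:
  assumes "smooth f"
  shows "smooth (vderiv f)"
proof -
  obtain f' where f': "\<And>x. (f has_derivative f' x) (at x)" "\<And>v. smooth (\<lambda>x. f' x v)"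
    using smooth_derivative[OF assms] by blast
  have "vderiv f = (\<lambda>x. f' x 1)"
    by (intro ext vderivI has_derivative_imp_has_vector_derivative f'(1))
  then show ?thesis using f' by simp
qed

text \<open>The operator inside \<open>ddx\<close>, so that \<open>ddx K \<Phi>\<close> is
  \<open>- K (partial_x \<Phi>)\<close>.\<close>

definition partial_x :: "(real \<times> real \<Rightarrow> complex) \<Rightarrow> real \<times> real \<Rightarrow> complex" where
  "partial_x \<Phi> = (\<lambda>(x, y). vderiv (\<lambda>t. \<Phi> (t, y)) x)"

lemma smooth_section_x:
  assumes "smooth \<Phi>"
  shows "smooth (\<lambda>t::real. \<Phi> (t, y::real))"
  using smooth_comp_affine[OF assms bounded_linear_Pair[OF bounded_linear_ident bounded_linear_zero],
      of "(0, y)"]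
  by simp

lemma partial_x_has_vector_derivative:
  assumes "smooth \<Phi>"
  shows "((\<lambda>t. \<Phi> (t, y)) has_vector_derivative partial_x \<Phi> (x, y)) (at x)"
  using smooth_has_vector_derivative[OF smooth_section_x[OF assms]] by (simp add: partial_x_def)

text \<open>Reading the partial derivative off the Frechet derivative transfers smoothness and
  support from \<open>\<Phi>\<close> to \<open>partial_x \<Phi>\<close>.\<close>

lemma partial_x_eq:
  assumes "(\<Phi> has_derivative f') (at (x, y))"
  shows "partial_x \<Phi> (x, y) = f' (1, 0)"
proof -
  have "((\<lambda>t. (t, y)) has_derivative (\<lambda>t. (t, 0))) (at x)"
    by (auto intro!: derivative_eq_intros)
  from vderivI[OF has_derivative_imp_has_vector_derivative[OF has_derivative_compose[OF this assms]]]
  show ?thesis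
    by (simp add: partial_x_def)
qed

lemma smooth_partial_x:
  assumes "smooth \<Phi>"
  shows "smooth (partial_x \<Phi>)"
proof -
  obtain f' where f': "\<And>x. (\<Phi> has_derivative f' x) (at x)" "\<And>v. smooth (\<lambda>x. f' x v)"
    using smooth_derivative[OF assms] by blast
  have "partial_x \<Phi> = (\<lambda>p. f' p (1, 0))"
    using partial_x_eq[OF f'(1)] by (auto simp: fun_eq_iff)
  then show ?thesis using f' by simp
qed

section \<open>Parameter integrals and Hadamard's lemma\<close>

lemma has_vector_derivative_integral_smooth:
  assumes "smooth H"
  shows "((\<lambda>t. integral {a..b} (\<lambda>s. H (t, s))) has_vector_derivative
            integral {a..b} (\<lambda>s. partial_x H (t, s))) (at t)"
proof -
  have "((\<lambda>t. integral (cbox a b) (\<lambda>s. H (t, s))) has_vector_derivative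
            integral (cbox a b) (\<lambda>s. partial_x H (t, s))) (at t within UNIV)"
  proof (rule leibniz_rule_vector_derivative[where fx = "\<lambda>t s. partial_x H (t, s)"])
    have "continuous_on (cbox a b) (\<lambda>s. H (t, s))" for t
      by (rule continuous_on_compose2[OF smooth_continuous_on[OF assms, of UNIV]])
        (intro continuous_on_Pair continuous_on_const continuous_on_id subset_UNIV)+
    then show "(\<lambda>s. H (t, s)) integrable_on cbox a b" for t
      by (rule integrable_continuous)
    show "continuous_on (UNIV \<times> cbox a b) (\<lambda>(t, s). partial_x H (t, s))"
      using smooth_continuous_on[OF smooth_partial_x[OF assms]] by simp
    show "((\<lambda>t. H (t, s)) has_vector_derivative partial_x H (t, s)) (at t within UNIV)" for t s
      using partial_x_has_vector_derivative[OF assms] by simp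
  qed simp_all
  then show ?thesis by simp
qed

lemma smooth_integral:
  fixes H :: "real \<times> real \<Rightarrow> complex"
  assumes "smooth H"
  shows "smooth (\<lambda>t. integral {a..b} (\<lambda>s. H (t, s)))"
  using assms
proof (coinduction arbitrary: H)
  case smooth
  \<comment> \<open>The scalar \<open>v\<close> is absorbed into the integrand, so that the
    directional derivative is again a parameter integral and the coinduction closes.\<close>
  have *: "\<exists>K. (\<lambda>t. v *\<^sub>R integral {a..b} (\<lambda>s. partial_x H (t, s))) =
        (\<lambda>t. integral {a..b} (\<lambda>s. K (t, s))) \<and> smooth K" for v
    by (rule exI[of _ "\<lambda>p. of_real v * partial_x H p"])
       (simp add: scaleR_conv_of_real smooth_mult smooth_const smooth_partial_x smooth)
  have "((\<lambda>t. integral {a..b} (\<lambda>s. H (t, s))) has_derivative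
      (\<lambda>v. v *\<^sub>R integral {a..b} (\<lambda>s. partial_x H (t, s)))) (at t)" for t
    using has_vector_derivative_integral_smooth[OF smooth] by (simp add: has_vector_derivative_def)
  then show ?case
    by (intro exI[of _ "\<lambda>t. integral {a..b} (\<lambda>s. H (t, s))"]
        exI[of _ "\<lambda>t v. v *\<^sub>R integral {a..b} (\<lambda>s. partial_x H (t, s))"] conjI allI refl disjI1 *)
qed

lemma smooth_of_real: "smooth (of_real :: real \<Rightarrow> complex)"
  by (intro smooth_bounded_linear bounded_linear_of_real)

text \<open>Integrating the \<open>s\<close>-derivative of \<open>f (t * s)\<close> from 0 to 1
  gives \<open>f t - f 0\<close>. The factor \<open>t\<close> comes out, and what remains is a
  smooth parameter integral.\<close>

lemma hadamard:
  assumes "smooth (f :: real \<Rightarrow> complex)"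
  obtains g where "smooth g" "\<And>t. f t = f 0 + of_real t * g t"
proof
  define g where "g = (\<lambda>t. integral {0..1} (\<lambda>s. vderiv f (t * s)))"
  \<comment> \<open>\<open>smooth_mult\<close> is for complex values. For this real product the
    directional derivatives are bounded linear in the point.\<close>
  have q: "smooth (\<lambda>p::real\<times>real. fst p * snd p)"
  proof (rule smooth.intros[where f' = "\<lambda>p v. fst p * snd v + fst v * snd p"])
    show "((\<lambda>p. fst p * snd p) has_derivative (\<lambda>v. fst p * snd v + fst v * snd p)) (at p)"
      for p :: "real \<times> real"
      by (intro has_derivative_mult bounded_linear_imp_has_derivative bounded_linear_fst bounded_linear_snd)
    show "smooth (\<lambda>p::real\<times>real. fst p * snd v + fst v * snd p)" for v :: "real \<times> real"
      by (intro smooth_bounded_linear bounded_linear_add bounded_linear_const_mult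
            bounded_linear_mult_const bounded_linear_fst bounded_linear_snd)
  qed
  show "smooth g"
    unfolding g_def using smooth_integral[OF smooth_comp_real[OF smooth_vderiv[OF assms] q], of 0 1] by simp
  have "((\<lambda>s. t *\<^sub>R vderiv f (t * s)) has_integral f (t * 1) - f (t * 0)) {0..1}" for t
  proof (rule fundamental_theorem_of_calculus)
    fix s
    show "((\<lambda>s. f (t * s)) has_vector_derivative t *\<^sub>R vderiv f (t * s)) (at s within {0..1})"
      using vector_diff_chain_at[of "\<lambda>s. t * s" t s f "vderiv f (t * s)"]
        smooth_has_vector_derivative[OF assms] has_vector_derivative_mult_right[of "\<lambda>s. s" 1 "at s" t]
      by (auto simp: o_def has_vector_derivative_id intro: has_vector_derivative_at_within)
  qed auto
  from integral_unique[OF this]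
  show "f t = f 0 + of_real t * g t" for t
    by (auto simp: g_def scaleR_conv_of_real)
qed

section \<open>Test functions and linear functionals\<close>

definition flat :: "real poly \<Rightarrow> real \<Rightarrow> real" where
  "flat p t = (if t > 0 then poly p (inverse t) / exp (inverse t) else 0)"

lemma poly_over_exp_tendsto_0: "((\<lambda>x::real. poly p x / exp x) \<longlongrightarrow> 0) at_top"
proof -
  have "((\<lambda>x::real. \<Sum>i\<le>degree p. coeff p i * (x ^ i / exp x)) \<longlongrightarrow> (\<Sum>i\<le>degree p. coeff p i * 0)) at_top"
    by (intro tendsto_sum tendsto_mult tendsto_const tendsto_power_div_exp_0)
  then show ?thesis
    by (simp add: poly_altdef sum_divide_distrib)
qed

text \<open>The polynomial in \<open>1 / t\<close> makes the family of multiples of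
  \<open>exp (- 1 / t)\<close> closed under differentiation. The factor \<open>[:0, 0, 1:]\<close>
  is the inner derivative \<open>1 / t^2\<close> up to sign, and at 0 the exponential beats every
  polynomial.\<close>

lemma flat_has_real_derivative:
  "(flat p has_real_derivative flat ([:0, 0, 1:] * (p - pderiv p)) t) (at t)"
proof -
  consider "t > 0" | "t < 0" | "t = 0" by linarith
  then show ?thesis
  proof cases
    case 1
    have "((\<lambda>t. poly p (inverse t) / exp (inverse t)) has_real_derivative
            flat ([:0, 0, 1:] * (p - pderiv p)) t) (at t)"
      using 1
      by (auto intro!: derivative_eq_intros DERIV_chain2[OF poly_DERIV]
          simp: flat_def field_simps power2_eq_square)
    then show ?thesis
      by (rule has_field_derivative_transform_within_open[where S = "{0<..}"])
         (use 1 in \<open>auto simp: flat_def\<close>)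
  next
    case 2
    have "((\<lambda>t. 0) has_real_derivative 0) (at t)" by simp
    then have "(flat p has_real_derivative 0) (at t)"
      by (rule has_field_derivative_transform_within_open[where S = "{..<0}"])
         (use 2 in \<open>auto simp: flat_def\<close>)
    then show ?thesis
      using 2 by (simp add: flat_def)
  next
    case 3
    \<comment> \<open>Dividing by \<open>y\<close> multiplies the polynomial in \<open>1 / y\<close>
      by its variable, which is \<open>pCons 0 p\<close>.\<close>
    have "((\<lambda>y. poly (pCons 0 p) (inverse y) / exp (inverse y)) \<longlongrightarrow> 0) (at_right (0::real))"
      by (rule filterlim_compose[OF poly_over_exp_tendsto_0 filterlim_inverse_at_top_right])
    moreover have "\<forall>\<^sub>F y in at_right (0::real).
        poly (pCons 0 p) (inverse y) / exp (inverse y) = (flat p y - flat p 0) / (y - 0)"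
      by (auto simp: eventually_at_right_less flat_def field_simps intro!: eventually_at_rightI[of 0 1])
    ultimately have r: "((\<lambda>y. (flat p y - flat p 0) / (y - 0)) \<longlongrightarrow> 0) (at_right 0)"
      by (rule Lim_transform_eventually)
    have "\<forall>\<^sub>F y in at_left (0::real). 0 = (flat p y - flat p 0) / (y - 0)"
      by (auto simp: flat_def intro!: eventually_at_leftI[of "-1" 0])
    from Lim_transform_eventually[OF tendsto_const this]
    have "((\<lambda>y. (flat p y - flat p 0) / (y - 0)) \<longlongrightarrow> 0) (at 0)"
      using r by (simp add: filterlim_at_split)
    then show ?thesis
      using 3 by (simp add: has_field_derivative_iff flat_def)
  qed
qed

lemma smooth_flat: "smooth (\<lambda>t. complex_of_real (flat p t))"
proof (coinduction arbitrary: p)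
  case smooth
  let ?q = "[:0, 0, 1:] * (p - pderiv p)"
  have "v *\<^sub>R complex_of_real (flat ?q t) = of_real (flat (Polynomial.smult v ?q) t)" for v t
    by (simp add: flat_def scaleR_conv_of_real)
  then have *: "\<exists>q. (\<lambda>t. v *\<^sub>R complex_of_real (flat ?q t)) = (\<lambda>t. of_real (flat q t))" for v
    by blast
  have "((\<lambda>t. complex_of_real (flat p t)) has_derivative (\<lambda>v. v *\<^sub>R of_real (flat ?q t))) (at t)" for t
    using has_vector_derivative_of_real[OF flat_has_real_derivative[of p t]]
    unfolding has_vector_derivative_def .
  then show ?case
    by (intro exI[of _ "\<lambda>t. of_real (flat p t)"] exI[of _ "\<lambda>t v. v *\<^sub>R of_real (flat ?q t)"]
        conjI allI refl disjI1 *)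
qed

section \<open>Stability of test functions under products, sums, derivatives and quotients\<close>

lemma test_function_on_smooth: "test_function_on U f \<Longrightarrow> smooth f"
  by (simp add: test_function_on_def)

text \<open>A closed subset of a compact support is compact and stays in \<open>U\<close>. Products,
  derivatives and quotients of test functions are all handled through this.\<close>

lemma test_function_on_subsupport:
  assumes "test_function_on U f" "smooth g" "\<And>x. g x \<noteq> 0 \<Longrightarrow> x \<in> closure {x. f x \<noteq> 0}"
  shows "test_function_on U g"
proof -
  have "closure {x. g x \<noteq> 0} \<subseteq> closure {x. f x \<noteq> 0}"
    using assms(3) by (intro closure_minimal) auto
  then show ?thesis
    using assms(1,2) compact_Int_closed[OF _ closed_closure, of "closure {x. f x \<noteq> 0}" "{x. g x \<noteq> 0}"]
    unfolding test_function_on_def by (auto simp: Int_absorb1)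
qed

lemma test_function_on_UNIV_iff:
  fixes f :: "'a::{real_normed_vector, heine_borel} \<Rightarrow> complex"
  shows "test_function_on UNIV f \<longleftrightarrow> smooth f \<and> bounded {x. f x \<noteq> 0}"
  by (simp add: test_function_on_def)

lemma test_function_on_UNIV: "test_function_on U f \<Longrightarrow> test_function_on UNIV f"
  by (simp add: test_function_on_def)

lemma test_function_on_mult:
  assumes "test_function_on U f" "smooth m"
  shows "test_function_on U (\<lambda>x. m x * f x)"
proof (rule test_function_on_subsupport[OF assms(1)])
  show "smooth (\<lambda>x. m x * f x)"
    by (rule smooth_mult[OF assms(2) test_function_on_smooth[OF assms(1)]])
  show "x \<in> closure {x. f x \<noteq> 0}" if "m x * f x \<noteq> 0" for x
    using that closure_subset[of "{x. f x \<noteq> 0}"] by auto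
qed

lemma test_function_on_zero: "test_function_on U (\<lambda>_. 0)"
  by (simp add: test_function_on_def smooth_const)

lemma test_function_on_add:
  assumes "test_function_on U f" "test_function_on U g"
  shows "test_function_on U (\<lambda>x. f x + g x)"
proof -
  have "closure {x. f x + g x \<noteq> 0} \<subseteq> closure {x. f x \<noteq> 0} \<union> closure {x. g x \<noteq> 0}"
    unfolding closure_Un[symmetric] by (intro closure_mono) auto
  moreover from this have "compact (closure {x. f x + g x \<noteq> 0})"
    using assms compact_Int_closed[OF _ closed_closure, of "closure {x. f x \<noteq> 0} \<union> closure {x. g x \<noteq> 0}"
        "{x. f x + g x \<noteq> 0}"]
    unfolding test_function_on_def by (auto simp: Int_absorb1 compact_Un)
  ultimately show ?thesis
    using assms smooth_add[of f g] unfolding test_function_on_def by auto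
qed

text \<open>The complement of the closed support is open, so \<open>f\<close> vanishes on a whole
  neighbourhood of \<open>x\<close>.\<close>

lemma has_derivative_outside_support:
  assumes "(f has_derivative f') (at x)" "x \<notin> closure {x. f x \<noteq> 0}"
  shows "f' v = 0"
proof -
  have "((\<lambda>_. 0) has_derivative (\<lambda>_. 0)) (at x)" by simp
  then have "(f has_derivative (\<lambda>_. 0)) (at x)"
    by (rule has_derivative_transform_within_open[where s = "- closure {x. f x \<noteq> 0}"])
       (use assms(2) closure_subset[of "{x. f x \<noteq> 0}"] in auto)
  then show ?thesis
    by (simp add: has_derivative_unique[OF assms(1)])
qed

lemma test_function_on_vderiv:
  assumes "test_function_on U f"
  shows "test_function_on U (vderiv f)"
proof (rule test_function_on_subsupport[OF assms smooth_vderiv[OF test_function_on_smooth[OF assms]]])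
  fix x assume "vderiv f x \<noteq> 0"
  moreover have "(f has_derivative (\<lambda>v. v *\<^sub>R vderiv f x)) (at x)"
    using smooth_has_vector_derivative[OF test_function_on_smooth[OF assms]]
    unfolding has_vector_derivative_def .
  ultimately show "x \<in> closure {x. f x \<noteq> 0}"
    using has_derivative_outside_support[of f "\<lambda>v. v *\<^sub>R vderiv f x" x 1] by auto
qed

lemma test_function_on_partial_x:
  assumes "test_function_on U \<Phi>"
  shows "test_function_on U (partial_x \<Phi>)"
proof (rule test_function_on_subsupport[OF assms smooth_partial_x[OF test_function_on_smooth[OF assms]]])
  fix p assume "partial_x \<Phi> p \<noteq> 0"
  moreover obtain f' where "(\<Phi> has_derivative f') (at p)"
    using smooth_derivative[OF test_function_on_smooth[OF assms]] by blast
  ultimately show "p \<in> closure {p. \<Phi> p \<noteq> 0}"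
    using partial_x_eq[of \<Phi> f' "fst p" "snd p"] has_derivative_outside_support[of \<Phi> f' p] by auto
qed

text \<open>Near a zero of \<open>g\<close> the numerator vanishes identically, so the convention
  that division by 0 gives 0 yields the right value there. The quotient rule keeps the class stable:
  the new numerator is supported where \<open>f\<close> is, and \<open>g * g\<close> has the zeros
  of \<open>g\<close>.\<close>

lemma smooth_divide:
  assumes "smooth f" "smooth g" "closure {x. f x \<noteq> 0} \<subseteq> {x. g x \<noteq> (0::complex)}"
  shows "smooth (\<lambda>x. f x / g x)"
  using assms
proof (coinduction arbitrary: f g)
  case smooth
  obtain f' where f': "\<And>x. (f has_derivative f' x) (at x)" "\<And>v. smooth (\<lambda>x. f' x v)"
    using smooth_derivative[OF smooth(1)] by blast
  obtain g' where g': "\<And>x. (g has_derivative g' x) (at x)" "\<And>v. smooth (\<lambda>x. g' x v)"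
    using smooth_derivative[OF smooth(2)] by blast
  let ?D = "\<lambda>x v. (f' x v * g x - f x * g' x v) / (g x * g x)"
  have deriv: "((\<lambda>x. f x / g x) has_derivative ?D x) (at x)" for x
  proof (cases "g x = 0")
    case True
    have "((\<lambda>_. 0) has_derivative (\<lambda>_. 0)) (at x)" by simp
    then have "((\<lambda>x. f x / g x) has_derivative (\<lambda>_. 0)) (at x)"
      by (rule has_derivative_transform_within_open[where s = "- closure {x. f x \<noteq> 0}"])
         (use True smooth(3) closure_subset[of "{x. f x \<noteq> 0}"] in auto)
    then show ?thesis using True by simp
  qed (use has_derivative_divide'[OF f'(1) g'(1)] in blast)
  have "closure {x. f' x v * g x - f x * g' x v \<noteq> 0} \<subseteq> closure {x. f x \<noteq> 0}" for v
    using has_derivative_outside_support[OF f'(1)] closure_subset[of "{x. f x \<noteq> 0}"]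
    by (intro closure_minimal) force+
  then have "closure {x. f' x v * g x - f x * g' x v \<noteq> 0} \<subseteq> {x. g x * g x \<noteq> 0}" for v
    using smooth(3) by fastforce
  then have *: "\<exists>F G. (\<lambda>x. ?D x v) = (\<lambda>x. F x / G x) \<and> smooth F \<and> smooth G \<and>
      closure {x. F x \<noteq> 0} \<subseteq> {x. G x \<noteq> 0}" for v
    by (intro exI[of _ "\<lambda>x. f' x v * g x - f x * g' x v"] exI[of _ "\<lambda>x. g x * g x"] conjI refl
        smooth_diff smooth_mult f'(2) g'(2) smooth(1,2))
  show ?case
    by (intro exI[of _ "\<lambda>x. f x / g x"] exI[of _ ?D] conjI allI refl disjI1 deriv *)
qed

section \<open>Integrals over the lines \<open>x - y = s\<close>\<close>

definition slice :: "(real \<times> real \<Rightarrow> complex) \<Rightarrow> real \<Rightarrow> complex" where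
  "slice \<Phi> s = integral UNIV (\<lambda>y. \<Phi> (y + s, y))"

lemma of_difference_slice: "of_difference T \<Phi> = T (slice \<Phi>)"
  by (simp add: of_difference_def slice_def[abs_def])

text \<open>In the coordinates \<open>s = x - y\<close> and \<open>y\<close>, slices become
  parameter integrals.\<close>

lemma smooth_shear: "smooth \<Phi> \<Longrightarrow> smooth (\<lambda>p. \<Phi> (snd p + fst p, snd p))"
  for \<Phi> :: "real \<times> real \<Rightarrow> complex"
  using smooth_comp_affine[of \<Phi> "\<lambda>p. (snd p + fst p, snd p)" "0"]
  by (simp add: bounded_linear_Pair bounded_linear_add bounded_linear_fst bounded_linear_snd)

lemma test_function_compact_support:
  assumes "test_function_on UNIV \<Phi>"
  obtains B where "B > 0" "\<forall>p. norm p \<ge> B \<longrightarrow> \<Phi> p = 0"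
proof -
  have "bounded {p. \<Phi> p \<noteq> 0}"
    using assms bounded_subset[OF compact_imp_bounded closure_subset]
    unfolding test_function_on_def by blast
  then obtain B where "B > 0" "\<And>p. \<Phi> p \<noteq> 0 \<Longrightarrow> norm p < B"
    unfolding bounded_pos_less by auto
  then show ?thesis
    using that by force
qed

text \<open>The interval for \<open>y\<close> does not depend on \<open>s\<close>, so the rules for
  parameter integrals over a fixed interval apply to slices.\<close>

lemma has_integral_slice:
  fixes \<Phi> :: "real \<times> real \<Rightarrow> complex"
  assumes "smooth \<Phi>" "\<forall>p. norm p \<ge> B \<longrightarrow> \<Phi> p = 0"
  shows "((\<lambda>y. \<Phi> (y + s, y)) has_integral integral {-B..B} (\<lambda>y. \<Phi> (y + s, y))) UNIV"
proof -
  have "continuous_on {-B..B} (\<lambda>y. \<Phi> (y + s, y))"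
    by (rule continuous_on_compose2[OF smooth_continuous_on[OF assms(1), of UNIV]])
       (intro continuous_intros subset_UNIV)+
  then have "((\<lambda>y. \<Phi> (y + s, y)) has_integral integral {-B..B} (\<lambda>y. \<Phi> (y + s, y))) {-B..B}"
    by (rule integrable_integral[OF integrable_continuous_real])
  moreover have "\<Phi> (y + s, y) = 0" if "y \<notin> {-B..B}" for y
    using that norm_snd_le[of y "y + s"] assms(2) by auto
  ultimately show ?thesis
    by (rule has_integral_on_superset) auto
qed

lemma slice_eq:
  fixes \<Phi> :: "real \<times> real \<Rightarrow> complex"
  assumes "smooth \<Phi>" "\<forall>p. norm p \<ge> B \<longrightarrow> \<Phi> p = 0"
  shows "slice \<Phi> = (\<lambda>s. integral {-B..B} (\<lambda>y. \<Phi> (y + s, y)))"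
  using has_integral_slice[OF assms] by (auto simp: slice_def fun_eq_iff integral_unique)

lemma slice_integrable:
  fixes \<Phi> :: "real \<times> real \<Rightarrow> complex"
  assumes "test_function_on UNIV \<Phi>"
  shows "(\<lambda>y. \<Phi> (y + s, y)) integrable_on UNIV"
proof -
  obtain B where "\<forall>p. norm p \<ge> B \<longrightarrow> \<Phi> p = 0"
    using assms test_function_compact_support by blast
  from has_integral_slice[OF test_function_on_smooth[OF assms] this] show ?thesis
    by (rule has_integral_integrable)
qed

lemma test_function_on_slice:
  fixes \<Phi> :: "real \<times> real \<Rightarrow> complex"
  assumes "test_function_on UNIV \<Phi>"
  shows "test_function_on UNIV (slice \<Phi>)"
proof -
  obtain B where B: "B > 0" "\<forall>p. norm p \<ge> B \<longrightarrow> \<Phi> p = 0"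
    using assms test_function_compact_support by blast
  have "smooth (slice \<Phi>)"
    unfolding slice_eq[OF test_function_on_smooth[OF assms] B(2)]
    using smooth_integral[OF smooth_shear[OF test_function_on_smooth[OF assms]], of "-B" B] by simp
  moreover have "slice \<Phi> s = 0" if "norm s > 2 * B" for s
  proof -
    \<comment> \<open>The numbers \<open>y + s\<close> and \<open>y\<close> differ by more than
      \<open>2 * B\<close>, so one of them exceeds \<open>B\<close> in absolute value.\<close>
    have "norm (y + s, y) \<ge> B" for y
      using that norm_fst_le[of "y + s" y] norm_snd_le[of y "y + s"] by auto
    then show ?thesis
      using B(2) by (simp add: slice_def)
  qed
  ultimately show ?thesis
    unfolding test_function_on_UNIV_iff by (force simp: bounded_iff not_less[symmetric])
qed

text \<open>With \<open>x = y + s\<close> and \<open>y\<close> held fixed, differentiation in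
  \<open>s\<close> is differentiation in \<open>x\<close>, and it passes under the integral.\<close>

lemma vderiv_slice:
  fixes \<Phi> :: "real \<times> real \<Rightarrow> complex"
  assumes "test_function_on UNIV \<Phi>"
  shows "vderiv (slice \<Phi>) = slice (partial_x \<Phi>)"
proof
  fix s
  note sm = test_function_on_smooth[OF assms]
  note pt = test_function_on_partial_x[OF assms]
  obtain B1 where B1: "B1 > 0" "\<forall>p. norm p \<ge> B1 \<longrightarrow> \<Phi> p = 0"
    using assms test_function_compact_support by blast
  obtain B2 where B2: "B2 > 0" "\<forall>p. norm p \<ge> B2 \<longrightarrow> partial_x \<Phi> p = 0"
    using pt test_function_compact_support by blast
  define B where "B = max B1 B2"
  have B: "\<forall>p. norm p \<ge> B \<longrightarrow> \<Phi> p = 0" "\<forall>p. norm p \<ge> B \<longrightarrow> partial_x \<Phi> p = 0"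
    using B1 B2 by (auto simp: B_def)
  let ?H = "\<lambda>p. \<Phi> (snd p + fst p, snd p)"
  have "partial_x ?H (s, y) = partial_x \<Phi> (y + s, y)" for y
  proof -
    obtain f' where f': "(\<Phi> has_derivative f') (at (y + s, y))"
      using smooth_derivative[OF sm] by blast
    have "((\<lambda>p. (snd p + fst p, snd p)) has_derivative (\<lambda>p. (snd p + fst p, snd p))) (at (s, y))"
      by (intro has_derivative_Pair has_derivative_add bounded_linear_imp_has_derivative
           bounded_linear_fst bounded_linear_snd)
    from has_derivative_compose[OF this, of \<Phi> f'] f'
    have "(?H has_derivative (\<lambda>p. f' (snd p + fst p, snd p))) (at (s, y))" by simp
    from partial_x_eq[OF this] partial_x_eq[OF f'] show ?thesis by simp
  qed
  then show "vderiv (slice \<Phi>) s = slice (partial_x \<Phi>) s"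
    using vderivI[OF has_vector_derivative_integral_smooth[OF smooth_shear[OF sm], of "-B" B s]]
    unfolding slice_eq[OF sm B(1)] slice_eq[OF test_function_on_smooth[OF pt] B(2)] by simp
qed

section \<open>Linear functionals on test functions, on the line and in the plane\<close>

definition linear_functional :: "'a::real_normed_vector functional \<Rightarrow> bool" where
  "linear_functional T \<longleftrightarrow>
     (\<forall>f g. test_function_on UNIV f \<longrightarrow> test_function_on UNIV g \<longrightarrow>
        T (\<lambda>t. f t + g t) = T f + T g) \<and>
     (\<forall>f k. test_function_on UNIV f \<longrightarrow> T (\<lambda>t. k * f t) = k * T f)"

lemma distribution_linear: "distribution T \<Longrightarrow> linear_functional T"
  by (simp add: distribution_def linear_functional_def)

context
  fixes T :: "'a::real_normed_vector functional"
  assumes T: "linear_functional T"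
begin

lemma functional_add:
  "test_function_on UNIV f \<Longrightarrow> test_function_on UNIV g \<Longrightarrow> T (\<lambda>t. f t + g t) = T f + T g"
  using T by (simp add: linear_functional_def)

lemma functional_mult: "test_function_on UNIV f \<Longrightarrow> T (\<lambda>t. k * f t) = k * T f"
  using T by (simp add: linear_functional_def)

lemma functional_zero: "T (\<lambda>t. 0) = 0"
  using functional_mult[OF test_function_on_zero, of 0] by simp

lemma functional_uminus: "test_function_on UNIV f \<Longrightarrow> T (\<lambda>t. - f t) = - T f"
  using functional_mult[of f "-1"] by simp

lemma functional_diff:
  assumes "test_function_on UNIV f" "test_function_on UNIV g"
  shows "T (\<lambda>t. f t - g t) = T f - T g"
  using functional_add[OF assms(1) test_function_on_mult[OF assms(2) smooth_const[of "-1"]]]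
    functional_uminus[OF assms(2)]
  by simp

end

lemma linear_of_difference:
  assumes "linear_functional T"
  shows "linear_functional (of_difference T)"
proof -
  have "slice (\<lambda>p. \<Phi> p + \<Psi> p) = (\<lambda>s. slice \<Phi> s + slice \<Psi> s)"
    if "test_function_on UNIV \<Phi>" "test_function_on UNIV \<Psi>" for \<Phi> \<Psi>
    using that by (auto simp: slice_def fun_eq_iff intro!: integral_add slice_integrable)
  moreover have "slice (\<lambda>p. k * \<Phi> p) = (\<lambda>s. k * slice \<Phi> s)" for k \<Phi>
    by (simp add: slice_def fun_eq_iff)
  ultimately show ?thesis
    unfolding linear_functional_def of_difference_slice
    using test_function_on_slice functional_add[OF assms] functional_mult[OF assms] by simp
qed

lemma linear_distr_deriv:
  assumes "linear_functional T"
  shows "linear_functional (distr_deriv T)"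
proof -
  have "vderiv (\<lambda>t. f t + g t) = (\<lambda>t. vderiv f t + vderiv g t)"
    if "test_function_on UNIV f" "test_function_on UNIV g" for f g
    using that by (intro ext vderivI has_vector_derivative_add smooth_has_vector_derivative
        test_function_on_smooth)
  moreover have "vderiv (\<lambda>t. k * f t) = (\<lambda>t. k * vderiv f t)" if "test_function_on UNIV f" for k f
    using that by (intro ext vderivI has_vector_derivative_mult_right smooth_has_vector_derivative
        test_function_on_smooth)
  ultimately show ?thesis
    unfolding linear_functional_def distr_deriv_def
    using test_function_on_vderiv functional_add[OF assms] functional_mult[OF assms]
    by (simp add: algebra_simps)
qed

text \<open>The dual form of the fact that the \<open>x\<close>-derivative of
  \<open>T(x - y)\<close> is \<open>T'(x - y)\<close>.\<close>

lemma ddx_of_difference: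
  assumes "test_function_on UNIV \<Phi>"
  shows "of_difference T (partial_x \<Phi>) = - of_difference (distr_deriv T) \<Phi>"
  by (simp add: of_difference_slice distr_deriv_def vderiv_slice[OF assms])

section \<open>Partial trace of the r-matrix and integration by parts\<close>

lemma sum_UNIV_pair: "(\<Sum>p\<in>UNIV. f p) = (\<Sum>a\<in>UNIV. \<Sum>b\<in>UNIV. f (a, b))"
  by (simp add: sum.cartesian_product)

lemma kron_mult: "kron A B ** kron C D = kron (A ** C) (B ** D)"
  by (simp add: kron_def matrix_matrix_mult_def vec_eq_iff sum_UNIV_pair sum_2 algebra_simps)

lemma kron_diff_mult:
  "kron A B ** (K - L) ** kron C D = kron A B ** K ** kron C D - kron A B ** L ** kron C D"
  by (simp add: matrix_matrix_mult_def vec_eq_iff algebra_simps sum_subtractf sum_distrib_right)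

definition partial_trace :: "mat4 \<Rightarrow> 2 \<Rightarrow> 2 \<Rightarrow> complex" where
  "partial_trace r l j = r $ (1, l) $ (1, j) + r $ (2, l) $ (2, j)"

lemma partial_trace_kron: "partial_trace (kron A B) l j = trace A * B $ l $ j"
  by (simp add: partial_trace_def kron_def trace_def sum_2 algebra_simps)

lemma partial_trace_diff: "partial_trace (K - L) l j = partial_trace K l j - partial_trace L l j"
  by (simp add: partial_trace_def)

lemma matrix_inv_left:
  assumes "invertible A"
  shows "matrix_inv A ** A = mat 1"
  using someI_ex[of "\<lambda>A'. A ** A' = mat 1 \<and> A' ** A = mat 1"] assms
  by (simp add: matrix_inv_def invertible_def)

text \<open>Conjugation acts on each tensor factor separately by \<open>kron_mult\<close>, and
  similar matrices have equal trace. So the first factor of either term of the wedge stays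
  traceless.\<close>

lemma partial_trace_conjugate_wedge:
  assumes "det g = 1" "trace A = 0" "trace B = 0"
  shows "partial_trace (kron g g ** wedge A B ** kron (matrix_inv g) (matrix_inv g)) l j = 0"
proof -
  have inv: "matrix_inv g ** g = mat 1"
    using assms(1) by (intro matrix_inv_left) (simp add: invertible_det_nz)
  have "trace (g ** X ** matrix_inv g) = trace X" for X
  proof -
    have "trace (g ** X ** matrix_inv g) = trace (matrix_inv g ** (g ** X))"
      by (rule trace_mul_sym)
    then show ?thesis
      by (simp only: matrix_mul_assoc inv matrix_mul_lid)
  qed
  then have "partial_trace (kron (g ** X ** matrix_inv g) Y) l j = 0" if "trace X = 0" for X Y
    using that by (simp add: partial_trace_kron)
  then show ?thesis
    using assms(2,3) unfolding wedge_def kron_diff_mult kron_mult partial_trace_diff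
    by simp
qed

lemma trace_sl2 [simp]: "trace sl2_e = 0" "trace sl2_f = 0" "trace sl2_h = 0"
  by (simp_all add: trace_def sum_2 sl2_e_def sl2_f_def sl2_h_def vector_def)

lemma partial_trace_r_matrix:
  assumes "classical_r_matrix r \<kappa>"
  shows "partial_trace r l j = 0"
proof -
  \<comment> \<open>In the third normal form the scalar \<open>\<epsilon>\<close> is moved out of
    the conjugation, which reduces it to a plain wedge.\<close>
  have scale: "kron g g ** (\<chi> p q. \<epsilon> * M $ p $ q) ** K = (\<chi> p q. \<epsilon> * (kron g g ** M ** K) $ p $ q)"
    for \<epsilon> :: complex and g M K
    by (simp add: matrix_matrix_mult_def vec_eq_iff sum_distrib_left sum_distrib_right mult_ac)
  have zero: "partial_trace (\<chi> p q. \<epsilon> * M $ p $ q) l j = \<epsilon> * partial_trace M l j" for \<epsilon> M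
    by (simp add: partial_trace_def algebra_simps)
  consider "conjugate4 r 0" | "conjugate4 r (wedge sl2_h sl2_f)"
    | \<epsilon> where "conjugate4 r (\<chi> p q. \<epsilon> * wedge sl2_e sl2_f $ p $ q)"
    using assms unfolding classical_r_matrix_def by blast
  then show ?thesis
  proof cases
    case 1
    then show ?thesis
      by (auto simp: conjugate4_def partial_trace_def)
  next
    case 2
    then show ?thesis
      by (auto simp: conjugate4_def partial_trace_conjugate_wedge)
  next
    case 3
    then show ?thesis
      by (auto simp: conjugate4_def scale zero partial_trace_conjugate_wedge)
  qed
qed

section \<open>Entries of \<open>R\<close> as functionals, and their derivatives\<close>

lemma linear_regular_one: "linear_functional (regular (\<lambda>_. 1))"
proof -
  have int: "f integrable_on UNIV" if f: "test_function_on UNIV f" for f :: "real \<Rightarrow> complex"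
  proof -
    obtain B where B: "\<forall>x. norm x \<ge> B \<longrightarrow> f x = 0"
      using f test_function_compact_support by blast
    have "f integrable_on {-B..B}"
      by (intro integrable_continuous_real smooth_continuous_on test_function_on_smooth[OF f])
    moreover have "f x = 0" if "x \<notin> {-B..B}" for x
      using B that by auto
    ultimately show ?thesis
      by (rule integrable_on_superset) auto
  qed
  then show ?thesis
    by (simp add: linear_functional_def regular_def integral_add)
qed

lemma linear_R_entry:
  assumes A: "linear_functional A" and C: "linear_functional C"
  shows "linear_functional (R_entry A C r p q)"
  using functional_add[OF A] functional_mult[OF A] functional_add[OF C] functional_mult[OF C]
    functional_add[OF linear_regular_one] functional_mult[OF linear_regular_one]
  by (simp add: linear_functional_def R_entry_def algebra_simps)

text \<open>By the fundamental theorem of calculus the integral of \<open>vderiv f\<close> is a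
  difference of boundary values, which vanish outside the support.\<close>

lemma distr_deriv_regular_one:
  assumes "test_function_on UNIV f"
  shows "distr_deriv (regular (\<lambda>_. 1)) f = 0"
proof -
  obtain B where B: "B > 0" "\<forall>x. norm x \<ge> B \<longrightarrow> f x = 0"
    using assms test_function_compact_support by blast
  obtain B' where B': "\<forall>x. norm x \<ge> B' \<longrightarrow> vderiv f x = 0"
    using test_function_compact_support[OF test_function_on_vderiv[OF assms]] by blast
  define b where "b = max B B'"
  have "-b \<le> b"
    using B by (simp add: b_def)
  then have "(vderiv f has_integral f b - f (-b)) {-b..b}"
    by (rule fundamental_theorem_of_calculus)
       (rule has_vector_derivative_at_within[OF smooth_has_vector_derivative[OF
          test_function_on_smooth[OF assms]]])
  then have "(vderiv f has_integral 0) {-b..b}"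
    using B by (simp add: b_def)
  moreover have "vderiv f x = 0" if "x \<notin> {-b..b}" for x
    using B' that by (auto simp: b_def)
  ultimately have "(vderiv f has_integral 0) UNIV"
    by (rule has_integral_on_superset) auto
  then show ?thesis
    by (simp add: distr_deriv_def regular_def integral_unique)
qed

lemma of_difference_R_entry:
  "of_difference (R_entry A C r p q) \<Phi> =
     mat 1 $ p $ q * of_difference A \<Phi> + c_block $ p $ q * of_difference C \<Phi>
     + r $ p $ q * of_difference (regular (\<lambda>_. 1)) \<Phi>"
  by (simp add: of_difference_slice R_entry_def)

text \<open>The matrix \<open>r\<close> multiplies a constant function, so it disappears on
  differentiation.\<close>

lemma of_difference_distr_deriv_R_entry:
  assumes "test_function_on UNIV \<Phi>"
  shows "of_difference (distr_deriv (R_entry A C r p q)) \<Phi> =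
     mat 1 $ p $ q * of_difference (distr_deriv A) \<Phi> + c_block $ p $ q * of_difference (distr_deriv C) \<Phi>"
  using distr_deriv_regular_one[OF test_function_on_slice[OF assms]]
  by (simp add: of_difference_slice distr_deriv_def R_entry_def)

section \<open>Integration by parts in the plane\<close>

lemma partial_x_mult:
  assumes "smooth f" "smooth \<Phi>"
  shows "partial_x (\<lambda>(x, y). f x * \<Phi> (x, y)) =
           (\<lambda>(x, y). vderiv f x * \<Phi> (x, y) + f x * partial_x \<Phi> (x, y))"
proof -
  have "vderiv (\<lambda>t. f t * \<Phi> (t, y)) x = vderiv f x * \<Phi> (x, y) + f x * partial_x \<Phi> (x, y)" for x y
    using has_vector_derivative_mult[OF smooth_has_vector_derivative[OF assms(1)]
        partial_x_has_vector_derivative[OF assms(2)]]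
    by (intro vderivI) (simp add: add_ac)
  then show ?thesis
    by (simp add: partial_x_def[of "\<lambda>(x, y). f x * \<Phi> (x, y)"])
qed

lemma test_function_on_mult_pair:
  assumes "test_function_on U \<Phi>" "smooth f" "smooth g"
  shows "test_function_on U (\<lambda>(x, y). f x * g y * \<Phi> (x, y))"
  using test_function_on_mult[OF assms(1) smooth_mult[OF smooth_fst[OF assms(2)] smooth_snd[OF assms(3)]]]
  by (simp add: case_prod_unfold)

lemma test_function_on_mult_fst:
  assumes "test_function_on U \<Phi>" "smooth f"
  shows "test_function_on U (\<lambda>(x, y). f x * \<Phi> (x, y))"
  using test_function_on_mult[OF assms(1) smooth_fst[OF assms(2)]]
  by (simp add: case_prod_unfold)

text \<open>Integration by parts moves the \<open>x\<close>-derivative from the bracket of evaluation functionals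
  onto \<open>T(x - y)\<close> and the coefficient \<open>f(x)\<close>.\<close>

lemma of_difference_by_parts:
  assumes T: "linear_functional T" and \<Psi>: "test_function_on UNIV \<Psi>"
    and f: "smooth f" and g: "smooth g" and d: "smooth d"
  shows "of_difference T (\<lambda>(x, y). f x * g y * partial_x (\<lambda>(x, y). d x * \<Psi> (x, y)) (x, y)) =
     - of_difference (distr_deriv T) (\<lambda>(x, y). f x * d x * g y * \<Psi> (x, y))
     - of_difference T (\<lambda>(x, y). vderiv f x * d x * g y * \<Psi> (x, y))"
proof -
  let ?G = "\<lambda>(x, y). d x * g y * \<Psi> (x, y)"
  have G: "test_function_on UNIV ?G"
    by (rule test_function_on_mult_pair[OF \<Psi> d g])
  have fG: "test_function_on UNIV (\<lambda>(x, y). f x * ?G (x, y))"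
    by (rule test_function_on_mult_fst[OF G f])
  have f'G: "test_function_on UNIV (\<lambda>(x, y). vderiv f x * ?G (x, y))"
    by (rule test_function_on_mult_fst[OF G smooth_vderiv[OF f]])
  \<comment> \<open>The factor \<open>g y\<close> is constant in \<open>x\<close>. The product rule
    for \<open>f\<close> and \<open>?G\<close> then gives the claim.\<close>
  have "partial_x ?G (x, y) = g y * partial_x (\<lambda>(x, y). d x * \<Psi> (x, y)) (x, y)" for x y
  proof -
    have "((\<lambda>t. g y * (d t * \<Psi> (t, y))) has_vector_derivative
        g y * partial_x (\<lambda>(x, y). d x * \<Psi> (x, y)) (x, y)) (at x)"
      using partial_x_has_vector_derivative[OF test_function_on_smooth[OF test_function_on_mult_fst[OF \<Psi> d]]]
      by (intro has_vector_derivative_mult_right) simp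
    from vderivI[OF this] show ?thesis
      by (simp add: partial_x_def mult_ac)
  qed
  then have "(\<lambda>(x, y). f x * g y * partial_x (\<lambda>(x, y). d x * \<Psi> (x, y)) (x, y)) =
      (\<lambda>p. partial_x (\<lambda>(x, y). f x * ?G (x, y)) p - (\<lambda>(x, y). vderiv f x * ?G (x, y)) p)"
    using partial_x_mult[OF f test_function_on_smooth[OF G]] by (auto simp: fun_eq_iff)
  moreover have "(\<lambda>(x, y). f x * d x * g y * \<Psi> (x, y)) = (\<lambda>(x, y). f x * ?G (x, y))"
      "(\<lambda>(x, y). vderiv f x * d x * g y * \<Psi> (x, y)) = (\<lambda>(x, y). vderiv f x * ?G (x, y))"
    by (simp_all add: mult.assoc)
  ultimately show ?thesis
    by (simp only: functional_diff[OF linear_of_difference[OF T] test_function_on_partial_x[OF fG] f'G]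
      ddx_of_difference[OF fG])
qed

section \<open>Brackets with the wronskian\<close>

lemma d_value_wronskian:
  "d_value wronskian_density 1 w = (\<lambda>x. vderiv w x $ 2)"
  "d_value wronskian_density 2 w = (\<lambda>x. - vderiv w x $ 1)"
  by (auto simp: d_value_def wronskian_density_def axis_def fun_eq_iff
      intro!: DERIV_imp_deriv derivative_eq_intros)

lemma d_deriv_wronskian:
  "d_deriv wronskian_density 1 w = (\<lambda>x. - w x $ 2)"
  "d_deriv wronskian_density 2 w = (\<lambda>x. w x $ 1)"
  by (auto simp: d_deriv_def wronskian_density_def axis_def fun_eq_iff
      intro!: DERIV_imp_deriv derivative_eq_intros)

lemma vderiv_vec_nth:
  assumes "smooth w"
  shows "vderiv (\<lambda>x. w x $ i) x = vderiv w x $ i"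
  by (rule vderivI[OF bounded_linear.has_vector_derivative[OF bounded_linear_vec_nth
        smooth_has_vector_derivative[OF assms]]])

lemma smooth_wronskian:
  assumes "smooth w"
  shows "smooth (wronskian w)"
proof -
  have "smooth (\<lambda>x. w x $ 1 * vderiv w x $ 2 - vderiv w x $ 1 * w x $ 2)"
    by (intro smooth_diff smooth_mult smooth_vec_nth[OF assms] smooth_vec_nth[OF smooth_vderiv[OF assms]])
  then show ?thesis
    by (simp add: wronskian_def[abs_def] wronskian_density_def)
qed

lemma c_block_simps [simp]:
  "c_block $ (i, i) $ q = 0" "c_block $ p $ (i, i) = 0"
  "c_block $ (1, 2) $ (1, 2) = 1" "c_block $ (2, 1) $ (2, 1) = 1"
  "c_block $ (1, 2) $ (2, 1) = -1" "c_block $ (2, 1) $ (1, 2) = -1"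
  by (simp_all add: c_block_def)

text \<open>Disposes of the \<open>ddy\<close> terms of \<open>bracket\<close> when the second
  density does not involve the derivative: they are values of the evaluation bracket at the test
  function 0.\<close>

lemma eval_bracket_zero:
  assumes "linear_functional A" "linear_functional C"
  shows "eval_bracket A C r w i j (\<lambda>_. 0) = 0"
  using functional_zero[OF linear_of_difference[OF linear_R_entry[OF assms]]]
  by (simp add: eval_bracket_def mult_def)

lemma vderiv_zero [simp]: "vderiv (\<lambda>_. 0) x = 0"
  by (simp add: vderiv_def)

text \<open>For the generators of \<open>W\<close>, the coefficients \<open>w\<^sub>k V\<^sub>i + w\<^sub>k' D\<^sub>i\<close> of the undifferentiated bracket
  reduce to \<open>W\<close> on the diagonal, so only the partial trace of \<open>R\<close> contributes there.\<close>

lemma bracket_wronskian: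
  assumes A: "linear_functional A" and C: "linear_functional C"
    and r: "\<And>l j. partial_trace r l j = 0"
    and w: "smooth w"
    and G: "\<And>j. d_deriv G j w = (\<lambda>_. 0)"
    and \<Psi>: "\<And>j. test_function_on UNIV (\<Psi> j)"
    and G\<Psi>: "\<And>j x y. d_value G j w y * \<Phi> (x, y) = \<Psi> j (x, y)"
  shows "bracket A C r wronskian_density G w \<Phi> =
     of_difference (\<lambda>f. C f + 2 * A f)
       (\<lambda>(x, y). wronskian w x * (w y $ 1 * \<Psi> 1 (x, y) + w y $ 2 * \<Psi> 2 (x, y)))
     - of_difference (distr_deriv C)
       (\<lambda>(x, y). (w x $ 1 * w y $ 2 - w x $ 2 * w y $ 1) *
                 (w x $ 1 * \<Psi> 1 (x, y) + w x $ 2 * \<Psi> 2 (x, y)))"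
proof -
  define V where "V = (\<lambda>i. d_value wronskian_density i w)"
  define D where "D = (\<lambda>i. d_deriv wronskian_density i w)"
  let ?R = "\<lambda>k l i j. R_entry A C r (k, l) (i, j)"
  let ?W = "wronskian w"
  \<comment> \<open>\<open>P\<close> collects the contributions of \<open>T(x - y)\<close> itself,
    \<open>Y\<close> those of its derivative.\<close>
  define P where "P = (\<lambda>T l j. of_difference T (\<lambda>(x, y). ?W x * w y $ l * \<Psi> j (x, y)))"
  define Y where "Y = (\<lambda>T k i l j.
    of_difference (distr_deriv T) (\<lambda>(x, y). w x $ k * D i x * w y $ l * \<Psi> j (x, y)))"
  note sw = smooth_vec_nth[OF w]
  note sW = smooth_wronskian[OF w]
  have V: "smooth (V i)" and D: "smooth (D i)" for i
    using exhaust_2[of i] smooth_vec_nth[OF smooth_vderiv[OF w]] sw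
    by (auto simp: V_def D_def d_value_wronskian d_deriv_wronskian smooth_uminus)
  have R: "linear_functional (?R k l i j)" for k l i j
    by (rule linear_R_entry[OF A C])
  have Z: "w x $ k * V i x + vderiv (\<lambda>x. w x $ k) x * D i x = (if k = i then ?W x else 0)" for k i x
    using exhaust_2[of k] exhaust_2[of i]
    by (auto simp: V_def D_def d_value_wronskian d_deriv_wronskian vderiv_vec_nth[OF w]
        wronskian_def wronskian_density_def)
  have tY: "test_function_on UNIV (\<lambda>(x, y). w x $ k * D i x * w y $ l * \<Psi> j (x, y))" for k i l j
    by (rule test_function_on_mult_pair[OF \<Psi> smooth_mult[OF sw D] sw])
  have tP: "test_function_on UNIV (\<lambda>(x, y). ?W x * w y $ l * \<Psi> j (x, y))" for l j
    by (rule test_function_on_mult_pair[OF \<Psi> sW sw])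
  \<comment> \<open>Integration by parts in the second term produces \<open>Y\<close> and a term
    with \<open>vderiv\<close> of the component \<open>k\<close>. By \<open>Z\<close> the latter
    combines with the first term into \<open>P\<close> if \<open>k = i\<close> and into 0
    otherwise.\<close>
  have entry: "of_difference (?R k l i j) (\<lambda>(x, y). w x $ k * w y $ l * (V i x * \<Psi> j (x, y)))
      - of_difference (?R k l i j)
          (\<lambda>(x, y). w x $ k * w y $ l * partial_x (\<lambda>(x, y). D i x * \<Psi> j (x, y)) (x, y))
      = (if k = i then P (?R k l i j) l j else 0) + Y (?R k l i j) k i l j" for k l i j
  proof -
    let ?F = "\<lambda>(x, y). w x $ k * V i x * w y $ l * \<Psi> j (x, y)"
    let ?F' = "\<lambda>(x, y). vderiv (\<lambda>x. w x $ k) x * D i x * w y $ l * \<Psi> j (x, y)"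
    have "of_difference (?R k l i j) (\<lambda>p. ?F p + ?F' p) =
        of_difference (?R k l i j) ?F + of_difference (?R k l i j) ?F'"
      by (intro functional_add[OF linear_of_difference[OF R]]
          test_function_on_mult_pair[OF \<Psi> smooth_mult[OF sw V] sw]
          test_function_on_mult_pair[OF \<Psi> smooth_mult[OF smooth_vderiv[OF sw] D] sw])
    moreover have "?F p + ?F' p = (if k = i then (\<lambda>(x, y). ?W x * w y $ l * \<Psi> j (x, y)) p else 0)" for p
      using Z[of "fst p" k i] by (cases p) (auto simp: distrib_right[symmetric])
    then have "(\<lambda>p. ?F p + ?F' p) = (if k = i then (\<lambda>(x, y). ?W x * w y $ l * \<Psi> j (x, y)) else (\<lambda>_. 0))"
      by auto
    ultimately have "of_difference (?R k l i j) ?F + of_difference (?R k l i j) ?F' =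
        (if k = i then P (?R k l i j) l j else 0)"
      using functional_zero[OF linear_of_difference[OF R]] by (auto simp: P_def)
    moreover have "(\<lambda>(x, y). w x $ k * w y $ l * (V i x * \<Psi> j (x, y))) = ?F"
      by (simp add: fun_eq_iff)
    ultimately show ?thesis
      unfolding of_difference_by_parts[OF R \<Psi> sw sw D]
      by (simp add: Y_def)
  qed
  have G\<Psi>': "d_value G j w (snd p) * \<Phi> p = \<Psi> j p" for j p
    using G\<Psi>[of j "snd p" "fst p"] by simp
  have "bracket A C r wronskian_density G w \<Phi> =
    (\<Sum>i\<in>UNIV. \<Sum>j\<in>UNIV. eval_bracket A C r w i j (\<lambda>(x, y). V i x * \<Psi> j (x, y))
       - eval_bracket A C r w i j (partial_x (\<lambda>(x, y). D i x * \<Psi> j (x, y))))"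
    unfolding bracket_def Let_def
    by (simp add: mult_def ddx_def ddy_def V_def D_def G case_prod_unfold
        mult.assoc G\<Psi> G\<Psi>' eval_bracket_zero[OF A C] partial_x_def)
  also have "\<dots> = (\<Sum>i\<in>UNIV. \<Sum>j\<in>UNIV. \<Sum>k\<in>UNIV. \<Sum>l\<in>UNIV.
      (if k = i then P (?R k l i j) l j else 0) + Y (?R k l i j) k i l j)"
    unfolding entry[symmetric] eval_bracket_def mult_def
    by (simp only: sum_subtractf case_prod_unfold prod.collapse)
  \<comment> \<open>The identity contributes each \<open>P A j j\<close> twice, and the block of
    \<open>C\<close> each \<open>P C j j\<close> once. The terms with \<open>r\<close> cancel by
    \<open>r2\<close>, those with the derivative of \<open>A\<close> by \<open>YA\<close>.\<close>
  also have "\<dots> = (P C 1 1 + P C 2 2) + 2 * (P A 1 1 + P A 2 2)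
      + (Y C 1 1 2 2 - Y C 1 2 2 1 - Y C 2 1 1 2 + Y C 2 2 1 1)"
  proof -
    have PR: "P (?R k l i j) m n = mat 1 $ (k, l) $ (i, j) * P A m n + c_block $ (k, l) $ (i, j) * P C m n
       + r $ (k, l) $ (i, j) * P (regular (\<lambda>_. 1)) m n" for k l i j m n
      unfolding P_def by (rule of_difference_R_entry)
    have YR: "Y (?R k l i j) k' i' m n =
       mat 1 $ (k, l) $ (i, j) * Y A k' i' m n + c_block $ (k, l) $ (i, j) * Y C k' i' m n"
      for k l i j k' i' m n
      unfolding Y_def by (rule of_difference_distr_deriv_R_entry[OF tY])
    \<comment> \<open>The two components of \<open>w\<close> paired with \<open>D\<close> give
      \<open>- \<phi> \<psi> + \<psi> \<phi> = 0\<close> at \<open>x\<close>.\<close>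
    have YA: "Y A 2 2 l j = - Y A 1 1 l j" for l j
    proof -
      have "(\<lambda>(x, y). w x $ 2 * D 2 x * w y $ l * \<Psi> j (x, y)) =
          (\<lambda>p. - (\<lambda>(x, y). w x $ 1 * D 1 x * w y $ l * \<Psi> j (x, y)) p)"
        by (auto simp: fun_eq_iff D_def d_deriv_wronskian)
      then show ?thesis
        unfolding Y_def
        by (simp only: functional_uminus[OF linear_of_difference[OF linear_distr_deriv[OF A]] tY])
    qed
    have r2: "r $ (2, l) $ (2, j) = - r $ (1, l) $ (1, j)" for l j
      using r[of l j] by (simp add: partial_trace_def add_eq_0_iff)
    show ?thesis
      by (simp add: sum_2 PR YR YA r2 mat_def algebra_simps)
  qed
  also have "P C 1 1 + P C 2 2 = of_difference C
       (\<lambda>(x, y). ?W x * (w y $ 1 * \<Psi> 1 (x, y) + w y $ 2 * \<Psi> 2 (x, y)))"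
    unfolding P_def functional_add[OF linear_of_difference[OF C] tP tP, symmetric]
    by (simp add: case_prod_unfold algebra_simps)
  also have "P A 1 1 + P A 2 2 = of_difference A
       (\<lambda>(x, y). ?W x * (w y $ 1 * \<Psi> 1 (x, y) + w y $ 2 * \<Psi> 2 (x, y)))"
    unfolding P_def functional_add[OF linear_of_difference[OF A] tP tP, symmetric]
    by (simp add: case_prod_unfold algebra_simps)
  also have "Y C 1 1 2 2 - Y C 1 2 2 1 - Y C 2 1 1 2 + Y C 2 2 1 1 = - of_difference (distr_deriv C)
       (\<lambda>(x, y). (w x $ 1 * w y $ 2 - w x $ 2 * w y $ 1) *
                 (w x $ 1 * \<Psi> 1 (x, y) + w x $ 2 * \<Psi> 2 (x, y)))"
  proof -
    let ?f = "\<lambda>k i l j (x, y). w x $ k * D i x * w y $ l * \<Psi> j (x, y)"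
    let ?L = "\<lambda>(x, y). (w x $ 1 * w y $ 2 - w x $ 2 * w y $ 1) *
                 (w x $ 1 * \<Psi> 1 (x, y) + w x $ 2 * \<Psi> 2 (x, y))"
    note lin = linear_of_difference[OF linear_distr_deriv[OF C]]
    \<comment> \<open>Grouping by \<open>\<Psi> 1\<close> and \<open>\<Psi> 2\<close>, the four
      terms share the factor \<open>\<phi>(x) \<psi>(y) - \<psi>(x) \<phi>(y)\<close>. The order of
      subtraction accounts for the minus sign of the result.\<close>
    have "(\<lambda>p. (?f 1 2 2 1 p + ?f 2 1 1 2 p) - (?f 1 1 2 2 p + ?f 2 2 1 1 p)) = ?L"
      by (auto simp: fun_eq_iff D_def d_deriv_wronskian algebra_simps)
    moreover have "of_difference (distr_deriv C)
        (\<lambda>p. (?f 1 2 2 1 p + ?f 2 1 1 2 p) - (?f 1 1 2 2 p + ?f 2 2 1 1 p)) =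
        Y C 1 2 2 1 + Y C 2 1 1 2 - (Y C 1 1 2 2 + Y C 2 2 1 1)"
      unfolding Y_def
      by (subst functional_diff[OF lin test_function_on_add[OF tY tY] test_function_on_add[OF tY tY]],
          subst (1 2) functional_add[OF lin tY tY]) (rule refl)
    ultimately show ?thesis by simp
  qed
  finally show ?thesis
    by (simp add: of_difference_slice)
qed

section \<open>Cutoffs, tensor products and curves\<close>

lemma test_functionI:
  fixes f :: "'a::{real_normed_vector, heine_borel} \<Rightarrow> complex"
  assumes "smooth f" "\<And>x. norm x \<ge> B \<Longrightarrow> f x = 0"
  shows "test_function_on UNIV f"
proof -
  have "{x. f x \<noteq> 0} \<subseteq> ball 0 B"
    using assms(2) by (force simp: not_le[symmetric])
  then show ?thesis
    using assms(1) bounded_ball bounded_subset unfolding test_function_on_UNIV_iff by blast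
qed

lemma smooth_reflect: "smooth f \<Longrightarrow> smooth (\<lambda>t. f (- t))"
  using smooth_comp_affine[of f uminus 0] bounded_linear_minus[OF bounded_linear_ident] by simp

lemma test_function_reflect:
  fixes f :: "real \<Rightarrow> complex"
  assumes "test_function_on UNIV f"
  shows "test_function_on UNIV (\<lambda>t. f (- t))"
proof -
  obtain B where "\<forall>x. norm x \<ge> B \<longrightarrow> f x = 0"
    using assms test_function_compact_support by blast
  then show ?thesis
    by (intro test_functionI[of _ B] smooth_reflect test_function_on_smooth[OF assms]) auto
qed

text \<open>\<open>flat 1\<close> is positive exactly on the positive reals, so the product is
  positive exactly on the open interval from -1 to 1; it is symmetric by construction.\<close>

definition bump :: "real \<Rightarrow> real" where
  "bump t = flat 1 (1 + t) * flat 1 (1 - t)"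

lemma test_function_bump: "test_function_on UNIV (\<lambda>t. complex_of_real (bump t))"
proof (rule test_functionI)
  have "smooth (\<lambda>t. complex_of_real (flat 1 (1 + t)) * complex_of_real (flat 1 (1 - t)))"
    using smooth_comp_affine[OF smooth_flat bounded_linear_ident, of 1 1]
      smooth_comp_affine[OF smooth_flat bounded_linear_minus[OF bounded_linear_ident], of 1 1]
    by (intro smooth_mult) simp_all
  then show "smooth (\<lambda>t. complex_of_real (bump t))"
    by (simp add: bump_def)
  show "complex_of_real (bump x) = 0" if "norm x \<ge> 1" for x
    using that by (auto simp: bump_def flat_def)
qed

lemma bump_even: "bump (- t) = bump t"
  by (simp add: bump_def)

lemma bump_nonneg: "bump t \<ge> 0"
  by (simp add: bump_def flat_def)

lemma bump_0_pos: "bump 0 > 0"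
  by (simp add: bump_def flat_def)

lemma ex_cutoff:
  obtains \<theta> where "test_function_on UNIV \<theta>" "\<theta> (0::real) = 1" "\<And>t. \<theta> (- t) = \<theta> t"
proof
  let ?\<theta> = "\<lambda>t. complex_of_real (1 / bump 0) * of_real (bump t)"
  show "test_function_on UNIV ?\<theta>"
    by (rule test_function_on_mult[OF test_function_bump smooth_const])
  show "?\<theta> 0 = 1" "?\<theta> (- t) = ?\<theta> t" for t
    using bump_0_pos by (simp_all add: bump_even)
qed

lemma ex_mollifier:
  obtains \<rho> :: "real \<Rightarrow> complex" where "test_function_on UNIV \<rho>" "integral UNIV \<rho> = 1"
proof -
  have cont: "continuous_on {-1..1} bump"
    using continuous_on_Re[OF smooth_continuous_on[OF test_function_on_smooth[OF test_function_bump]]]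
    by simp
  define I where "I = integral {-1..1} bump"
  have I: "(bump has_integral I) {-1..1}"
    unfolding I_def by (intro integrable_integral integrable_continuous_real cont)
  \<comment> \<open>A nonnegative continuous function with integral 0 would vanish on the interval,
    but \<open>bump 0\<close> is positive.\<close>
  have "I \<noteq> 0"
  proof
    assume "I = 0"
    then have "bump 0 = 0"
      using integral_eq_0_iff[OF cont] bump_nonneg by (simp add: I_def)
    then show False using bump_0_pos by simp
  qed
  have "bump x = 0" if "x \<notin> {-1..1}" for x
    using that by (auto simp: bump_def flat_def)
  then have "(bump has_integral I) UNIV"
    using has_integral_on_superset[OF I] by auto
  then have "((\<lambda>t. complex_of_real (bump t)) has_integral of_real I) UNIV"
    by (rule has_integral_of_real)
  then have "integral UNIV (\<lambda>t. of_real (1 / I) * complex_of_real (bump t)) = of_real (1 / I) * of_real I"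
    by (intro integral_unique has_integral_mult_right)
  also have "\<dots> = 1"
    using \<open>I \<noteq> 0\<close> by simp
  finally have "integral UNIV (\<lambda>t. of_real (1 / I) * complex_of_real (bump t)) = 1" .
  then show ?thesis
    by (intro that[OF test_function_on_mult[OF test_function_bump smooth_const]])
qed

section \<open>Products of test functions in \<open>x - y\<close> and \<open>y\<close>\<close>

lemma test_function_tensor:
  assumes f: "test_function_on UNIV f" and \<rho>: "test_function_on UNIV \<rho>"
  shows "test_function_on UNIV (\<lambda>p::real \<times> real. f (fst p - snd p) * \<rho> (snd p))"
proof -
  obtain B where B: "B > 0" "\<forall>x. norm x \<ge> B \<longrightarrow> f x = 0"
    using f test_function_compact_support by blast
  obtain B' where B': "B' > 0" "\<forall>x. norm x \<ge> B' \<longrightarrow> \<rho> x = 0"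
    using \<rho> test_function_compact_support by blast
  have "smooth (\<lambda>p. f (fst p - snd p))"
    using smooth_comp_affine[OF test_function_on_smooth[OF f]
        bounded_linear_sub[OF bounded_linear_fst bounded_linear_snd], of 0] by simp
  then have "smooth (\<lambda>p. f (fst p - snd p) * \<rho> (snd p))"
    by (rule smooth_mult[OF _ smooth_snd[OF test_function_on_smooth[OF \<rho>]]])
  \<comment> \<open>From \<open>|x - y| < B\<close> and \<open>|y| < B'\<close> follows
    \<open>|x| < B + B'\<close>, hence \<open>|x| + |y| < B + 2 * B'\<close>.\<close>
  moreover have "f (fst p - snd p) * \<rho> (snd p) = 0" if "norm p \<ge> B + 2 * B'" for p
  proof (rule ccontr)
    assume "f (fst p - snd p) * \<rho> (snd p) \<noteq> 0"
    then have "\<bar>fst p - snd p\<bar> < B" "\<bar>snd p\<bar> < B'"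
      using B B' by (auto simp: not_le[symmetric])
    then show False
      using that norm_Pair_le[of "fst p" "snd p"] by auto
  qed
  ultimately show ?thesis
    by (rule test_functionI)
qed

text \<open>On the line \<open>x - y = s\<close> the product is \<open>f s * \<rho> y\<close>, so
  its slice is \<open>f\<close>. Statements about \<open>T(x - y)\<close> in the plane thereby yield
  statements about \<open>T\<close>.\<close>

lemma of_difference_tensor:
  assumes "integral UNIV \<rho> = 1"
  shows "of_difference T (\<lambda>p. f (fst p - snd p) * \<rho> (snd p)) = T f"
  using assms by (simp add: of_difference_slice slice_def[abs_def])

section \<open>Quasi-periodic curves for testing the conditions\<close>

lemma quasi_periodic_curve_smooth: "quasi_periodic_curve w \<Longrightarrow> smooth w"
  by (simp add: quasi_periodic_curve_def)

lemma smooth_affine: "smooth (\<lambda>x. u + x *\<^sub>R v)"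
  by (rule smooth.intros[where f' = "\<lambda>_ x. x *\<^sub>R v"])
     (auto intro!: derivative_eq_intros smooth_const)

lemma quasi_periodic_lines:
  "quasi_periodic_curve (\<lambda>x. vector [1, of_real x])"
  "quasi_periodic_curve (\<lambda>x. vector [of_real x, 1])"
proof -
  have eq: "(\<lambda>x. vector [1, of_real x] :: complex^2) = (\<lambda>x. vector [1, 0] + x *\<^sub>R vector [0, 1])"
    "(\<lambda>x. vector [of_real x, 1] :: complex^2) = (\<lambda>x. vector [0, 1] + x *\<^sub>R vector [1, 0])"
    by (auto simp: fun_eq_iff vec_eq_iff forall_2 of_real_def)
  have "smooth (\<lambda>x. vector [1, of_real x] :: complex^2)" "smooth (\<lambda>x. vector [of_real x, 1] :: complex^2)"
    unfolding eq by (rule smooth_affine)+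
  then show "quasi_periodic_curve (\<lambda>x. vector [1, of_real x])"
    "quasi_periodic_curve (\<lambda>x. vector [of_real x, 1])"
    unfolding quasi_periodic_curve_def
    \<comment> \<open>The monodromies are unipotent: a shift by \<open>2 * pi\<close> adds that
      multiple of the constant component to the other one.\<close>
    by (intro conjI exI[of _ "vector [vector [1, 2 * of_real pi], vector [0, 1]] :: mat2"]
          exI[of _ "vector [vector [1, 0], vector [2 * of_real pi, 1]] :: mat2"];
        simp add: det_2 vec_eq_iff forall_2 vector_matrix_mult_def sum_2)+
qed

section \<open>The brackets of the wronskian with \<open>\<phi>\<close> and \<open>\<eta>\<close>\<close>

lemma bracket_wronskian_phi:
  assumes A: "linear_functional A" and C: "linear_functional C"
    and r: "\<And>l j. partial_trace r l j = 0"
    and w: "smooth w" and \<Phi>: "test_function_on UNIV \<Phi>"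
  shows "bracket A C r wronskian_density phi_density w \<Phi> =
     mult (\<lambda>(x, y). wronskian w x * w y $ 1) (of_difference (\<lambda>f. C f + 2 * A f)) \<Phi> - last_term C w \<Phi>"
proof -
  \<comment> \<open>The gradient of \<open>\<phi>\<close> is \<open>(1, 0)\<close>.\<close>
  let ?\<Psi> = "\<lambda>j. if j = (1::2) then \<Phi> else (\<lambda>_. 0)"
  have "d_deriv phi_density j w = (\<lambda>_. 0)" for j
    by (simp add: d_deriv_def phi_density_def fun_eq_iff)
  moreover have "d_value phi_density j w y = (if j = 1 then 1 else 0)" for j y
    using exhaust_2[of j]
    by (auto simp: d_value_def phi_density_def axis_def intro!: DERIV_imp_deriv derivative_eq_intros)
  moreover have "test_function_on UNIV (?\<Psi> j)" for j
    using \<Phi> by (simp add: test_function_on_zero)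
  ultimately show ?thesis
    by (subst bracket_wronskian[OF A C r w, of _ ?\<Psi>])
       (auto simp: mult_def last_term_def case_prod_unfold mult_ac)
qed

text \<open>The gradient \<open>(1 / \<psi>, - \<phi> / \<psi>^2)\<close> of \<open>\<eta>\<close>
  at \<open>y\<close> annihilates \<open>w y\<close>, because \<open>\<eta>\<close> is homogeneous
  of degree 0; this removes the term with \<open>W\<close>. Paired with \<open>w x\<close> it gives
  \<open>(\<phi>(x) \<psi>(y) - \<psi>(x) \<phi>(y)) / \<psi>(y)^2\<close>, whence the
  square.\<close>

lemma bracket_wronskian_eta:
  assumes A: "linear_functional A" and C: "linear_functional C"
    and r: "\<And>l j. partial_trace r l j = 0"
    and w: "smooth w" and \<Phi>: "test_function_on {(x, y). w y $ 2 \<noteq> 0} \<Phi>"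
  shows "test_function_on UNIV (\<lambda>(x, y). (w x $ 1 * w y $ 2 - w x $ 2 * w y $ 1)\<^sup>2 / (w y $ 2)\<^sup>2 * \<Phi> (x, y))"
      (is "test_function_on UNIV ?L")
    and "bracket A C r wronskian_density eta_density w \<Phi> = - of_difference (distr_deriv C)
       (\<lambda>(x, y). (w x $ 1 * w y $ 2 - w x $ 2 * w y $ 1)\<^sup>2 / (w y $ 2)\<^sup>2 * \<Phi> (x, y))"
proof -
  \<comment> \<open>The support of \<open>\<Phi>\<close> stays away from the zeros of
    \<open>\<psi>(y)\<close>, so these quotients are test functions on the whole plane.\<close>
  let ?\<Psi> = "\<lambda>j p. (if j = (1::2) then \<Phi> p / w (snd p) $ 2 else - w (snd p) $ 1 * (\<Phi> p / (w (snd p) $ 2)\<^sup>2))"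
  note s\<Phi> = test_function_on_smooth[OF \<Phi>]
  note s1 = smooth_vec_nth[OF w]
  have supp: "closure {p. \<Phi> p \<noteq> 0} \<subseteq> {p. w (snd p) $ 2 \<noteq> 0}"
    using \<Phi> by (auto simp: test_function_on_def)
  have zero: "\<Phi> (x, y) = 0" if "w y $ 2 = 0" for x y
    using that supp closure_subset[of "{p. \<Phi> p \<noteq> 0}"] by force
  have sub: "p \<in> closure {p. \<Phi> p \<noteq> 0}" if "\<Phi> p / g p \<noteq> 0" for p and g :: "real \<times> real \<Rightarrow> complex"
    using that closure_subset[of "{p. \<Phi> p \<noteq> 0}"] by auto
  have t1: "test_function_on UNIV (\<lambda>p. \<Phi> p / w (snd p) $ 2)"
    by (rule test_function_on_UNIV[OF test_function_on_subsupport[OF \<Phi> smooth_divide sub]])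
       (use supp in \<open>auto intro: s\<Phi> smooth_snd[OF s1]\<close>)
  have t2: "test_function_on UNIV (\<lambda>p. \<Phi> p / (w (snd p) $ 2)\<^sup>2)"
    by (rule test_function_on_UNIV[OF test_function_on_subsupport[OF \<Phi> smooth_divide sub]])
       (use supp in \<open>auto intro: s\<Phi> smooth_power[OF smooth_snd[OF s1]]\<close>)
  have t: "test_function_on UNIV (?\<Psi> j)" for j
    using t1 test_function_on_mult[OF t2 smooth_uminus[OF smooth_snd[OF s1, of 1]]]
    by (cases "j = 1") simp_all
  have "smooth (\<lambda>p. (w (fst p) $ 1 * w (snd p) $ 2 - w (fst p) $ 2 * w (snd p) $ 1)\<^sup>2)"
    by (intro smooth_power smooth_diff smooth_mult smooth_snd[OF s1] smooth_fst[OF s1])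
  from test_function_on_mult[OF t2 this] show "test_function_on UNIV ?L"
    by (simp add: case_prod_unfold)
  have G: "d_deriv eta_density j w = (\<lambda>_. 0)" for j
    by (simp add: d_deriv_def eta_density_def fun_eq_iff)
  have G\<Psi>: "d_value eta_density j w y * \<Phi> (x, y) = ?\<Psi> j (x, y)" for j x y
  proof (cases "w y $ 2 = 0")
    case False
    have "d_value eta_density 1 w y = 1 / w y $ 2"
      using False
      by (auto simp: d_value_def eta_density_def axis_def power2_eq_square
          intro!: DERIV_imp_deriv derivative_eq_intros)
    moreover have "d_value eta_density 2 w y = - w y $ 1 / (w y $ 2)\<^sup>2"
      using False
      by (auto simp: d_value_def eta_density_def axis_def power2_eq_square
          intro!: DERIV_imp_deriv derivative_eq_intros)
    ultimately show ?thesis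
      using exhaust_2[of j] by auto
  qed (simp add: zero)
  have "(\<lambda>(x, y). wronskian w x * (w y $ 1 * ?\<Psi> 1 (x, y) + w y $ 2 * ?\<Psi> 2 (x, y))) = (\<lambda>_. 0)"
    by (simp add: fun_eq_iff power2_eq_square)
  moreover have "(\<lambda>(x, y). (w x $ 1 * w y $ 2 - w x $ 2 * w y $ 1) *
      (w x $ 1 * ?\<Psi> 1 (x, y) + w x $ 2 * ?\<Psi> 2 (x, y))) = ?L"
  proof (rule ext, clarify)
    fix x y
    show "(w x $ 1 * w y $ 2 - w x $ 2 * w y $ 1) *
      (w x $ 1 * ?\<Psi> 1 (x, y) + w x $ 2 * ?\<Psi> 2 (x, y)) =
      (w x $ 1 * w y $ 2 - w x $ 2 * w y $ 1)\<^sup>2 / (w y $ 2)\<^sup>2 * \<Phi> (x, y)"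
      by (cases "w y $ 2 = 0") (simp_all add: zero power2_eq_square field_simps)
  qed
  moreover have "of_difference (\<lambda>f. C f + 2 * A f) (\<lambda>_. 0) = 0"
    using functional_zero[OF linear_of_difference[OF A]] functional_zero[OF linear_of_difference[OF C]]
    by (simp add: of_difference_slice)
  ultimately show "bracket A C r wronskian_density eta_density w \<Phi> = - of_difference (distr_deriv C) ?L"
    using bracket_wronskian[OF A C r w G t G\<Psi>] by (simp only: diff_0)
qed

section \<open>Distributions supported at the origin\<close>

text \<open>Dirac evaluates the slice at 0, which is the integral along the diagonal.\<close>

lemma of_difference_dirac_eq_0:
  assumes "eq_on UNIV T (\<lambda>f. k * dirac f)" "test_function_on UNIV \<Psi>" "\<And>y. \<Psi> (y, y) = 0"
  shows "of_difference T \<Psi> = 0"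
  using assms test_function_on_slice[OF assms(2)]
  by (simp add: eq_on_def of_difference_slice dirac_def slice_def)

text \<open>Away from the origin \<open>g t\<close> is \<open>f t / t\<close>, so it vanishes
  outside the bounded set carrying \<open>f\<close>.\<close>

lemma hadamard_test_function:
  fixes f :: "real \<Rightarrow> complex"
  assumes "test_function_on UNIV f" "f 0 = 0"
  obtains g where "test_function_on UNIV g" "\<And>t. f t = of_real t * g t"
proof -
  obtain g where g: "smooth g" "\<And>t. f t = f 0 + of_real t * g t"
    using hadamard[OF test_function_on_smooth[OF assms(1)]] by blast
  obtain B where B: "B > 0" "\<forall>x. norm x \<ge> B \<longrightarrow> f x = 0"
    using assms(1) test_function_compact_support by blast
  have "g x = 0" if "norm x \<ge> B" for x
    using g(2)[of x] B that assms(2) by auto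
  with g assms(2) show ?thesis
    by (intro that[of g] test_functionI[of g B]) auto
qed

text \<open>For a cutoff \<open>\<theta>\<close> equal to 1 at 0, the function
  \<open>f - f 0 * \<theta>\<close> vanishes at 0 and so is \<open>t\<close> times a test function.
  Hence \<open>T f = f 0 * T \<theta>\<close>, and the constant is
  \<open>T \<theta>\<close>.\<close>

lemma multiple_of_dirac:
  assumes T: "linear_functional T"
    and "\<And>f. test_function_on UNIV f \<Longrightarrow> T (\<lambda>t. of_real t * f t) = 0"
  shows "\<exists>k. eq_on UNIV T (\<lambda>f. k * dirac f)"
proof -
  obtain \<theta> where \<theta>: "test_function_on UNIV \<theta>" "\<theta> (0::real) = 1"
    using ex_cutoff by blast
  have "T f = T \<theta> * dirac f" if f: "test_function_on UNIV f" for f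
  proof -
    note t\<theta> = test_function_on_mult[OF \<theta>(1) smooth_const[of "f 0"]]
    have "test_function_on UNIV (\<lambda>t. f t - f 0 * \<theta> t)"
      using test_function_on_add[OF f test_function_on_mult[OF \<theta>(1) smooth_const[of "- f 0"]]] by simp
    then obtain g where "test_function_on UNIV g" "\<And>t. f t - f 0 * \<theta> t = of_real t * g t"
      using hadamard_test_function[of "\<lambda>t. f t - f 0 * \<theta> t"] \<theta>(2) by auto
    then have "T (\<lambda>t. f t - f 0 * \<theta> t) = 0"
      using assms(2) by simp
    then show ?thesis
      using functional_diff[OF T f t\<theta>] functional_mult[OF T \<theta>(1), of "f 0"] by (simp add: dirac_def)
  qed
  then show ?thesis
    unfolding eq_on_def by blast
qed

text \<open>\<open>t\<^sup>2 T = 0\<close> alone would also allow a multiple of the derivative of \<open>\<delta>\<close>, which is odd.\<close>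

lemma even_multiple_of_dirac:
  assumes T: "linear_functional T"
    and even: "\<And>f. test_function_on UNIV f \<Longrightarrow> T (\<lambda>t. f (- t)) = T f"
    and sq: "\<And>f. test_function_on UNIV f \<Longrightarrow> T (\<lambda>t. (of_real t)\<^sup>2 * f t) = 0"
  shows "\<exists>k. eq_on UNIV T (\<lambda>f. k * dirac f)"
proof (rule multiple_of_dirac[OF T])
  fix f :: "real \<Rightarrow> complex" assume f: "test_function_on UNIV f"
  note f' = test_function_reflect[OF f]
  note sm = smooth_of_real
  have "test_function_on UNIV (\<lambda>t. f t - f (- t))"
    using test_function_on_add[OF f test_function_on_mult[OF f' smooth_const[of "-1"]]] by simp
  then obtain g where g: "test_function_on UNIV g" "\<And>t. f t - f (- t) = of_real t * g t"
    using hadamard_test_function[of "\<lambda>t. f t - f (- t)"] by auto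
  \<comment> \<open>\<open>f t - f (- t)\<close> is divisible by \<open>t\<close>, so
    \<open>t\<close> times it is \<open>t^2\<close> times a test function.\<close>
  have "0 = T (\<lambda>t. of_real t * f t - of_real t * f (- t))"
    using sq[OF g(1)] by (simp add: right_diff_distrib[symmetric] g(2) power2_eq_square mult.assoc)
  also have "\<dots> = T (\<lambda>t. of_real t * f t) - T (\<lambda>t. of_real t * f (- t))"
    by (rule functional_diff[OF T test_function_on_mult[OF f sm] test_function_on_mult[OF f' sm]])
  \<comment> \<open>Evenness is applied to \<open>t * f (- t)\<close>, whose reflection is
    \<open>- t * f t\<close>.\<close>
  also have "T (\<lambda>t. of_real t * f (- t)) = - T (\<lambda>t. of_real t * f t)"
    using even[OF test_function_on_mult[OF f' sm]] functional_uminus[OF T test_function_on_mult[OF f sm]]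
    by simp
  finally show "T (\<lambda>t. of_real t * f t) = 0"
    by simp
qed

text \<open>Differentiating a reflected function produces a sign, which cancels the sign from the
  oddness of \<open>T\<close>.\<close>

lemma distr_deriv_even:
  assumes T: "linear_functional T"
    and odd: "\<And>f. test_function_on UNIV f \<Longrightarrow> T (\<lambda>t. f (- t)) = - T f"
    and f: "test_function_on UNIV f"
  shows "distr_deriv T (\<lambda>t. f (- t)) = distr_deriv T f"
proof -
  note f' = test_function_on_vderiv[OF f]
  have "vderiv (\<lambda>t. f (- t)) x = - vderiv f (- x)" for x
    using vector_diff_chain_at[OF has_vector_derivative_minus[OF has_vector_derivative_id]
        smooth_has_vector_derivative[OF test_function_on_smooth[OF f]]]
    by (intro vderivI) (simp add: o_def)
  then have "vderiv (\<lambda>t. f (- t)) = (\<lambda>x. - vderiv f (- x))" ..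
  then show ?thesis
    using functional_uminus[OF T test_function_reflect[OF f']] odd[OF f'] by (simp add: distr_deriv_def)
qed

section \<open>Primitives of test functions and the sign function\<close>

lemma primitive_test_function:
  fixes u :: "real \<Rightarrow> complex"
  assumes u: "smooth u" and B: "B > 0" "\<forall>x. norm x \<ge> B \<longrightarrow> u x = 0"
    and zero: "integral {-B..B} u = 0"
  defines "F \<equiv> \<lambda>t. integral {-B..t} u"
  shows "test_function_on UNIV F" "vderiv F = u"
proof -
  have int: "u integrable_on {a..b}" for a b
    by (intro integrable_continuous_real smooth_continuous_on u)
  have F: "(F has_vector_derivative u t) (at t)" for t
  proof -
    \<comment> \<open>For \<open>t < - B\<close> the interval in \<open>F\<close> is empty. Starting
      at \<open>a\<close> instead makes \<open>t\<close> an interior point for the fundamental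
      theorem, and adds only an integral of 0.\<close>
    define a where "a = min (- B) t - 1"
    have a: "a < - B" "a < t" by (auto simp: a_def)
    have "((\<lambda>x. integral {a..x} u) has_vector_derivative u t) (at t within {a..t + 1})"
      using a by (intro integral_has_vector_derivative smooth_continuous_on u) auto
    then have "((\<lambda>x. integral {a..x} u) has_vector_derivative u t) (at t)"
      using a by (simp add: at_within_Icc_at)
    then show ?thesis
    proof (rule has_vector_derivative_transform_within_open[where S = "{a<..}"])
      fix x assume x: "x \<in> {a<..}"
      show "integral {a..x} u = F x"
      proof (cases "x < - B")
        case True
        have "integral {a..x} u = integral {a..x} (\<lambda>_. 0)"
          using True B by (intro integral_cong) auto
        then show ?thesis using True by (simp add: F_def)
      next
        case False
        have "integral {a..-B} u = integral {a..-B} (\<lambda>_. 0)"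
          using B by (intro integral_cong) auto
        then show ?thesis
          using Henstock_Kurzweil_Integration.integral_combine[of a "-B" x u] a False int
          by (simp add: F_def)
      qed
    qed (use a in auto)
  qed
  then show "vderiv F = u"
    by (intro ext vderivI)
  have "smooth F"
  proof (rule smooth.intros[where f' = "\<lambda>t v. v *\<^sub>R u t"])
    show "(F has_derivative (\<lambda>v. v *\<^sub>R u t)) (at t)" for t
      using F by (simp add: has_vector_derivative_def)
    show "smooth (\<lambda>t. v *\<^sub>R u t)" for v
      using smooth_mult[OF smooth_const[of "of_real v"] u] by (simp add: scaleR_conv_of_real)
  qed
  moreover have "F x = 0" if "norm x \<ge> B" for x
  proof (cases "x \<le> - B")
    case True
    then show ?thesis by (cases "x = -B") (auto simp: F_def)
  next
    case False
    then have "x \<ge> B" using that by auto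
    have "integral {B..x} u = integral {B..x} (\<lambda>_. 0)"
      using B by (intro integral_cong) auto
    then show ?thesis
      using Henstock_Kurzweil_Integration.integral_combine[of "-B" B x u] \<open>x \<ge> B\<close> B int zero
      by (simp add: F_def)
  qed
  ultimately show "test_function_on UNIV F"
    by (rule test_functionI)
qed

lemma regular_sgn:
  assumes f: "smooth f" and B: "B > 0" "\<forall>x. norm x \<ge> B \<longrightarrow> f x = 0"
  shows "regular (\<lambda>t. of_real (sgn t)) f = integral {0..B} f - integral {-B..0} f"
proof -
  have int: "(f has_integral integral {a..b} f) {a..b}" for a b
    by (intro integrable_integral integrable_continuous_real smooth_continuous_on f)
  have "((\<lambda>t. of_real (sgn t) * f t) has_integral integral {0..B} f) {0..B}"
    by (rule has_integral_spike_finite[OF _ _ int, of "{0}"]) auto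
  moreover have "((\<lambda>t. of_real (sgn t) * f t) has_integral - integral {-B..0} f) {-B..0}"
    by (rule has_integral_spike_finite[OF _ _ has_integral_neg[OF int], of "{0}"]) auto
  ultimately have "((\<lambda>t. of_real (sgn t) * f t) has_integral - integral {-B..0} f + integral {0..B} f) {-B..B}"
    using B by (intro has_integral_combine[of "-B" 0 B]) auto
  then have "((\<lambda>t. of_real (sgn t) * f t) has_integral - integral {-B..0} f + integral {0..B} f) UNIV"
    by (rule has_integral_on_superset) (use B in auto)
  then show ?thesis
    by (simp add: regular_def integral_unique)
qed

text \<open>Forward, \<open>distr_deriv T\<close> is applied to the primitive of
  \<open>f t - f (- t)\<close>, on which \<open>T\<close> takes the value \<open>2 * T f\<close> by
  oddness. Backward, the derivative of the sign function is \<open>2 * dirac\<close>; hence the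
  factors \<open>k / 2\<close> and \<open>2 * k\<close>.\<close>

lemma distr_deriv_dirac_iff_sgn:
  assumes T: "linear_functional T"
    and odd: "\<And>f. test_function_on UNIV f \<Longrightarrow> T (\<lambda>t. f (- t)) = - T f"
  shows "(\<exists>k. eq_on UNIV (distr_deriv T) (\<lambda>f. k * dirac f)) \<longleftrightarrow>
         (\<exists>k. eq_on UNIV T (\<lambda>f. k * regular (\<lambda>t. of_real (sgn t)) f))"
proof
  assume "\<exists>k. eq_on UNIV (distr_deriv T) (\<lambda>f. k * dirac f)"
  then obtain k where k: "\<And>f. test_function_on UNIV f \<Longrightarrow> distr_deriv T f = k * f 0"
    by (auto simp: eq_on_def dirac_def)
  have "T f = k / 2 * regular (\<lambda>t. of_real (sgn t)) f" if f: "test_function_on UNIV f" for f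
  proof -
    note sf = test_function_on_smooth[OF f]
    obtain B where B: "B > 0" "\<forall>x. norm x \<ge> B \<longrightarrow> f x = 0"
      using f test_function_compact_support by blast
    have int: "f integrable_on {a..b}" "(\<lambda>t. f (- t)) integrable_on {a..b}" for a b
      by (intro integrable_continuous_real smooth_continuous_on sf smooth_reflect)+
    define u where "u = (\<lambda>t. f t - f (- t))"
    have u: "smooth u" "\<forall>x. norm x \<ge> B \<longrightarrow> u x = 0"
      using B smooth_diff[OF sf smooth_reflect[OF sf]] by (auto simp: u_def)
    have "integral {-B..B} u = 0"
      using Henstock_Kurzweil_Integration.integral_reflect_real[of B "-B" f] by (simp add: u_def integral_diff int)
    note F = primitive_test_function[OF u(1) B(1) u(2) this]
    \<comment> \<open>Dirac evaluates the primitive of \<open>u\<close> at 0.\<close>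
    have "- T u = k * integral {-B..0} u"
      using k[OF F(1)] F(2) by (simp add: distr_deriv_def)
    moreover have "T u = 2 * T f"
      using functional_diff[OF T f test_function_reflect[OF f]] odd[OF f] by (simp add: u_def)
    moreover have "integral {-B..0} u = integral {-B..0} f - integral {0..B} f"
      using Henstock_Kurzweil_Integration.integral_reflect_real[of B 0 f] by (simp add: u_def integral_diff int)
    ultimately show ?thesis
      unfolding regular_sgn[OF sf B] by (simp add: field_simps)
  qed
  then show "\<exists>k. eq_on UNIV T (\<lambda>f. k * regular (\<lambda>t. of_real (sgn t)) f)"
    unfolding eq_on_def by blast
next
  assume "\<exists>k. eq_on UNIV T (\<lambda>f. k * regular (\<lambda>t. of_real (sgn t)) f)"
  then obtain k where k: "\<And>f. test_function_on UNIV f \<Longrightarrow> T f = k * regular (\<lambda>t. of_real (sgn t)) f"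
    by (auto simp: eq_on_def)
  have "distr_deriv T f = (2 * k) * dirac f" if f: "test_function_on UNIV f" for f
  proof -
    note f' = test_function_on_vderiv[OF f]
    obtain B1 where B1: "B1 > 0" "\<forall>x. norm x \<ge> B1 \<longrightarrow> f x = 0"
      using f test_function_compact_support by blast
    obtain B2 where B2: "\<forall>x. norm x \<ge> B2 \<longrightarrow> vderiv f x = 0"
      using test_function_compact_support[OF f'] by blast
    define B where "B = max B1 B2"
    have B: "B > 0" "\<forall>x. norm x \<ge> B \<longrightarrow> f x = 0" "\<forall>x. norm x \<ge> B \<longrightarrow> vderiv f x = 0"
      using B1 B2 by (auto simp: B_def)
    have FTC: "integral {a..b} (vderiv f) = f b - f a" if "a \<le> b" for a b
      by (rule integral_unique[OF fundamental_theorem_of_calculus[OF that]])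
         (rule has_vector_derivative_at_within[OF smooth_has_vector_derivative[OF test_function_on_smooth[OF f]]])
    show ?thesis
      using k[OF f'] FTC[of 0 B] FTC[of "-B" 0] B
      by (simp add: distr_deriv_def dirac_def regular_sgn[OF test_function_on_smooth[OF f'] B(1) B(3)])
  qed
  then show "\<exists>k. eq_on UNIV (distr_deriv T) (\<lambda>f. k * dirac f)"
    unfolding eq_on_def by blast
qed

section \<open>The bracket formula and the equivalent conditions on \<open>c\<close>\<close>

theorem proposition2p8:
  fixes a c :: "real \<Rightarrow> complex"
    and Sa Sc :: "real set"
    and A C :: "real functional"
    and r :: mat4
    and \<kappa> :: complex
  assumes a_odd: "odd_generalized_function a Sa A"
    and c_odd: "odd_generalized_function c Sc C"
    and r_matrix: "classical_r_matrix r \<kappa>"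
    and jacobi: "jacobi_condition c Sc \<kappa>"
  shows "(\<forall>w. quasi_periodic_curve w \<longrightarrow>
             eq_on UNIV (bracket A C r wronskian_density phi_density w)
               (\<lambda>\<Phi>. mult (\<lambda>(x, y). wronskian w x * w y $ 1)
                       (of_difference (\<lambda>f. C f + 2 * A f)) \<Phi>
                    - last_term C w \<Phi>)) \<and>
         (eta_commutes_with_wronskian A C r \<longleftrightarrow>
             (\<forall>w. quasi_periodic_curve w \<longrightarrow> eq_on UNIV (last_term C w) (\<lambda>_. 0))) \<and>
         ((\<forall>w. quasi_periodic_curve w \<longrightarrow> eq_on UNIV (last_term C w) (\<lambda>_. 0)) \<longleftrightarrow>
             (\<exists>k. eq_on UNIV (distr_deriv C) (\<lambda>f. k * dirac f))) \<and>
         ((\<exists>k. eq_on UNIV (distr_deriv C) (\<lambda>f. k * dirac f)) \<longleftrightarrow>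
             (\<exists>k. eq_on UNIV C (\<lambda>f. k * regular (\<lambda>t. of_real (sgn t)) f)))"
proof -
  have A: "linear_functional A" and C: "linear_functional C"
    using a_odd c_odd by (auto simp: odd_generalized_function_def distribution_linear)
  have odd: "C (\<lambda>t. f (- t)) = - C f" if "test_function_on UNIV f" for f
    using c_odd that by (simp add: odd_generalized_function_def)
  note C' = linear_distr_deriv[OF C]
  note r = partial_trace_r_matrix[OF r_matrix]
  note eta = bracket_wronskian_eta[OF A C r quasi_periodic_curve_smooth]
  obtain \<rho> :: "real \<Rightarrow> complex" where \<rho>: "test_function_on UNIV \<rho>" "integral UNIV \<rho> = 1"
    by (rule ex_mollifier)
  let ?delta = "\<exists>k. eq_on UNIV (distr_deriv C) (\<lambda>f. k * dirac f)"
  let ?last = "\<forall>w. quasi_periodic_curve w \<longrightarrow> eq_on UNIV (last_term C w) (\<lambda>_. 0)"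
  have "?last" if "?delta"
  proof (intro allI impI)
    fix w assume "quasi_periodic_curve w"
    note s = smooth_vec_nth[OF quasi_periodic_curve_smooth[OF this]]
    have "smooth (\<lambda>p. w (fst p) $ 1 * (w (fst p) $ 1 * w (snd p) $ 2 - w (fst p) $ 2 * w (snd p) $ 1))"
      by (intro smooth_diff smooth_mult smooth_fst[OF s] smooth_snd[OF s])
    note m = test_function_on_mult[OF _ this]
    show "eq_on UNIV (last_term C w) (\<lambda>_. 0)"
      unfolding eq_on_def
    proof (intro allI impI)
      fix \<Phi> :: "real \<times> real \<Rightarrow> complex" assume "test_function_on UNIV \<Phi>"
      from that of_difference_dirac_eq_0[OF _ m[OF this]] show "last_term C w \<Phi> = 0"
        by (auto simp: last_term_def mult_def case_prod_unfold mult.commute)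
    qed
  qed
  moreover have "?delta" if "?last"
  proof (rule multiple_of_dirac[OF C'])
    fix f :: "real \<Rightarrow> complex" assume f: "test_function_on UNIV f"
    \<comment> \<open>On the curve \<open>(1, x)\<close> the coefficient of the last term is
      \<open>y - x\<close>, which explains the outer sign.\<close>
    have "0 = - last_term C (\<lambda>x. vector [1, of_real x]) (\<lambda>p. f (fst p - snd p) * \<rho> (snd p))"
      using that quasi_periodic_lines(1) test_function_tensor[OF f \<rho>(1)] by (auto simp: eq_on_def)
    also have "\<dots> = - of_difference (distr_deriv C)
        (\<lambda>p. - (of_real (fst p - snd p) * f (fst p - snd p) * \<rho> (snd p)))"
      by (simp add: last_term_def mult_def case_prod_unfold algebra_simps)
    also have "\<dots> = distr_deriv C (\<lambda>t. of_real t * f t)"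
      using functional_uminus[OF linear_of_difference[OF C'] test_function_tensor[OF test_function_on_mult[OF f smooth_of_real] \<rho>(1)]]
        of_difference_tensor[OF \<rho>(2), of "distr_deriv C" "\<lambda>t. of_real t * f t"]
      by simp
    finally show "distr_deriv C (\<lambda>t. of_real t * f t) = 0" by simp
  qed
  moreover have "eta_commutes_with_wronskian A C r" if "?delta"
    unfolding eta_commutes_with_wronskian_def eq_on_def
  proof (intro allI impI)
    fix w and \<Phi> :: "real \<times> real \<Rightarrow> complex"
    assume "quasi_periodic_curve w" "test_function_on {(x, y). w y $ 2 \<noteq> 0} \<Phi>"
    from that of_difference_dirac_eq_0[OF _ eta(1)[OF this]] eta(2)[OF this]
    show "bracket A C r wronskian_density eta_density w \<Phi> = 0"
      by auto
  qed
  moreover have "?delta" if comm: "eta_commutes_with_wronskian A C r"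
  proof (rule even_multiple_of_dirac[OF C' distr_deriv_even[OF C odd]])
    fix f :: "real \<Rightarrow> complex" assume f: "test_function_on UNIV f"
    let ?w = "\<lambda>x. vector [of_real x, 1] :: complex^2"
    let ?\<Phi> = "\<lambda>p. f (fst p - snd p) * \<rho> (snd p)"
    \<comment> \<open>Here \<open>\<psi> = 1\<close>, so the chart of \<open>\<eta>\<close> is the
      whole plane.\<close>
    have t: "test_function_on {(x, y). ?w y $ 2 \<noteq> 0} ?\<Phi>"
      using test_function_tensor[OF f \<rho>(1)] by (simp add: UNIV_def[symmetric] case_prod_unfold)
    have "0 = - bracket A C r wronskian_density eta_density ?w ?\<Phi>"
      using comm quasi_periodic_lines(2) t by (simp add: eta_commutes_with_wronskian_def eq_on_def)
    \<comment> \<open>On the curve \<open>(x, 1)\<close> the squared coefficient is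
      \<open>(x - y)^2\<close> with denominator 1.\<close>
    also have "\<dots> = of_difference (distr_deriv C)
        (\<lambda>p. (of_real (fst p - snd p))\<^sup>2 * f (fst p - snd p) * \<rho> (snd p))"
      using eta(2)[OF quasi_periodic_lines(2) t] by (simp add: case_prod_unfold mult_ac)
    also have "\<dots> = distr_deriv C (\<lambda>t. (of_real t)\<^sup>2 * f t)"
      by (rule of_difference_tensor[OF \<rho>(2)])
    finally show "distr_deriv C (\<lambda>t. (of_real t)\<^sup>2 * f t) = 0" by simp
  qed
  moreover have "\<forall>w. quasi_periodic_curve w \<longrightarrow>
             eq_on UNIV (bracket A C r wronskian_density phi_density w)
               (\<lambda>\<Phi>. mult (\<lambda>(x, y). wronskian w x * w y $ 1)
                       (of_difference (\<lambda>f. C f + 2 * A f)) \<Phi>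
                    - last_term C w \<Phi>)"
    using bracket_wronskian_phi[OF A C r quasi_periodic_curve_smooth] by (simp add: eq_on_def)
  \<comment> \<open>Commutation with \<open>W\<close> and vanishing of the last term are each
    equivalent to \<open>?delta\<close>, hence to each other.\<close>
  ultimately show ?thesis
    using distr_deriv_dirac_iff_sgn[OF C odd] by blast
qed

end
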